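(* Let $d=3$. There is an absolute constant $c>0$ such that for every integer $N\ge1$ and every set $\mathcal P_N\subset[0,1]^3$ of exactly $N$ points, the discrepancy function $D_N$ of $\mathcal P_N$ satisfies $$\|D_N\|_{1}\cdot\|D_N\|_{L(\log L)}\ge c\,(\log N)^2.$$
   Context: For a set $\mathcal P_N\subset[0,1]^3$ of cardinality $N$, its discrepancy function is $$D_N(x)=\sharp(\mathcal P_N\cap[0,x))-N\,|[0,x)|,\qquad x=(x_1,x_2,x_3)\in[0,1]^3,$$ where $[0,x)=\prod_{j=1}^3[0,x_j)$ and $|\cdot|$ is Lebesgue measure. $\|\cdot\|_1$ is the norm of $L^1([0,1]^3)$, and $\|\cdot\|_{L(\log L)}$ is the norm of the Orlicz space $L\log L$ on $[0,1]^3$ with Lebesgue measure, e.g. the Luxemburg norm $\|f\|_{L(\log L)}=\inf\{\lambda>0:\int_{[0,1]^3}\psi(|f(x)|/\lambda)\,dx\le1\}$ with $\psi(t)=t\log(e+t)$ (any equivalent norm changes only the constant $c$). *)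

theory Defs
  imports "HOL-Analysis.Analysis"
begin

definition unit_cube :: "(real ^ 3) set" where
  "unit_cube = {x. \<forall>j. 0 \<le> x $ j \<and> x $ j \<le> 1}"

definition anchored_box :: "real ^ 3 \<Rightarrow> (real ^ 3) set" where
  "anchored_box x = {y. \<forall>j. 0 \<le> y $ j \<and> y $ j < x $ j}"

text \<open>The number \<open>N\<close> of points is \<^term>\<open>card P\<close>; the definition is meant for finite \<open>P\<close>.\<close>

definition discrepancy :: "(real ^ 3) set \<Rightarrow> real ^ 3 \<Rightarrow> real" where
  "discrepancy P x =
     real (card (P \<inter> anchored_box x)) - real (card P) * measure lborel (anchored_box x)"

text \<open>The two norms are real-valued and are meant for functions that belong to the space in
  question (in particular for bounded Borel functions, such as the discrepancy function).\<close>

definition L1_norm :: "(real ^ 3 \<Rightarrow> real) \<Rightarrow> real" where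
  "L1_norm f = (LINT x:unit_cube|lborel. \<bar>f x\<bar>)"

definition LlogL_young :: "real \<Rightarrow> real" where
  "LlogL_young t = t * ln (exp 1 + t)"

text \<open>The Luxemburg norm. The integral is the nonnegative extended one, so that an \<open>r\<close> for which
  it diverges is not admitted.\<close>

definition LlogL_norm :: "(real ^ 3 \<Rightarrow> real) \<Rightarrow> real" where
  "LlogL_norm f =
     Inf {r::real. 0 < r \<and>
        (\<integral>\<^sup>+ x \<in> unit_cube. ennreal (LlogL_young (\<bar>f x\<bar> / r)) \<partial>lborel) \<le> 1}"

end

theory Submission
  imports Defs "HOL-Probability.Hoeffding"
begin
text \<open>
  Choose \<open>n\<close> with \<open>2 N \<le> 2\<^sup>n \<le> 4 N\<close>. For a fixed dyadic scale \<open>k \<le> n\<close> in the first coordinate,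
  Halasz's two-dimensional Riesz product in the other two coordinates gives a bounded function
  \<open>T\<^sub>k\<close> that is a martingale difference of level \<open>k\<close> in the first coordinate and satisfies
  \<open>\<langle>D, T\<^sub>k\<rangle> \<ge> c (n - k + 1) / sqrt n\<close>. The sum \<open>G\<close> of the \<open>T\<^sub>k\<close> therefore has
  \<open>\<langle>D, G\<rangle> \<ge> c n\<^bsup>3/2\<^esup>\<close>, while \<open>G\<^sup>2 / n\<close> is exponentially integrable. By Cauchy-Schwarz and the
  duality of \<open>L log L\<close> and \<open>exp L\<close>,
  \<open>c n\<^sup>3 \<le> \<langle>D, G\<rangle>\<^sup>2 \<le> (\<integral> \<bar>D\<bar>) (\<integral> \<bar>D\<bar> G\<^sup>2) \<le> C n \<parallel>D\<parallel>\<^sub>1 \<parallel>D\<parallel>\<^bsub>L log L\<^esub>\<close>.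

  The Haar coefficients of the test functions are set to zero on all boxes that contain a point of
  \<open>P\<close>, so that only the linear part of \<open>D\<close> contributes to the pairings, and these can be computed
  exactly.
\<close>

section \<open>Dyadic cells and Rademacher functions\<close>

definition dcell :: "nat \<Rightarrow> real \<Rightarrow> int" where
  "dcell k t = \<lfloor>2 ^ k * t\<rfloor>"

text \<open>An even index at level \<open>k + 1\<close> marks the left half of a
  level-\<open>k\<close> interval, so \<open>rad k\<close> is 1 on left halves and -1 on right
  halves. It has mean zero on cells of level \<open>k\<close> and is constant only on cells of level
  \<open>k + 1\<close>.\<close>

definition rad :: "nat \<Rightarrow> real \<Rightarrow> real" where
  "rad k t = (if even (dcell (Suc k) t) then 1 else -1)"

text \<open>Exchanges the two halves of the level-\<open>k\<close> interval containing
  \<open>x $ j\<close>. This measure-preserving involution stands in for Fubini in coordinate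
  \<open>j\<close>: every integral against a Rademacher function below is evaluated through
  it.\<close>

definition half_swap :: "3 \<Rightarrow> nat \<Rightarrow> real ^ 3 \<Rightarrow> real ^ 3" where
  "half_swap j k x = x + axis j (rad k (x $ j) / 2 ^ Suc k)"

text \<open>The half-open cube \<open>[0,1)^3\<close>, written with cell indices so that invariance
  under all half swaps is immediate.\<close>

definition dyadic_cube :: "(real ^ 3) set" where
  "dyadic_cube = {x. \<forall>j. dcell 0 (x $ j) = 0}"

definition cube_measure :: "(real ^ 3) measure" where
  "cube_measure = restrict_space lborel dyadic_cube"

lemma dcell_coarsen:
  assumes "l \<le> k"
  shows "dcell l t = dcell k t div 2 ^ (k - l)"
proof -
  have "(2::real) ^ k = 2 ^ l * 2 ^ (k - l)"
    using assms by (simp flip: power_add)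
  then have "(2::real) ^ l * t = (2 ^ k * t) / real_of_int (2 ^ (k - l))"
    by simp
  then show ?thesis
    unfolding dcell_def by (simp only: floor_divide_real_eq_div zero_le_power zero_le_numeral)
qed

lemma dcell_eq_mono: "dcell k s = dcell k t \<Longrightarrow> l \<le> k \<Longrightarrow> dcell l s = dcell l t"
  by (simp add: dcell_coarsen)

lemma rad_cong: "dcell k s = dcell k t \<Longrightarrow> l < k \<Longrightarrow> rad l s = rad l t"
  unfolding rad_def by (metis Suc_leI dcell_eq_mono)

lemma rad_square [simp]: "rad k t * rad k t = 1"
  by (simp add: rad_def)

lemma abs_rad [simp]: "\<bar>rad k t\<bar> = 1"
  by (simp add: rad_def)

text \<open>After scaling by \<open>2 ^ Suc k\<close> the shift is by the integer 1 or -1, which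
  passes through the floor.\<close>

lemma dcell_Suc_shift: "dcell (Suc k) (t + rad k t / 2 ^ Suc k)
    = (if even (dcell (Suc k) t) then dcell (Suc k) t + 1 else dcell (Suc k) t - 1)"
proof -
  have "(2::real) ^ Suc k * (t + rad k t / 2 ^ Suc k) = 2 ^ Suc k * t + rad k t"
    by (simp add: distrib_left)
  moreover have "\<lfloor>s + rad k t\<rfloor> = (if even (dcell (Suc k) t) then \<lfloor>s\<rfloor> + 1 else \<lfloor>s\<rfloor> - 1)" for s
    by (cases "even (dcell (Suc k) t)") (simp_all add: rad_def)
  ultimately show ?thesis
    by (simp only: dcell_def[of "Suc k" "t + rad k t / 2 ^ Suc k"]) (simp only: dcell_def)
qed

text \<open>The swap exchanges the indices \<open>2 * c\<close> and \<open>2 * c + 1\<close>, which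
  have the same quotient by 2; so the level-\<open>k\<close> cell is kept, and with it every coarser
  one.\<close>

lemma dcell_shift: "l \<le> k \<Longrightarrow> dcell l (t + rad k t / 2 ^ Suc k) = dcell l t"
proof (rule dcell_eq_mono[of k])
  show "dcell k (t + rad k t / 2 ^ Suc k) = dcell k t"
    using dcell_Suc_shift[of k t] unfolding dcell_coarsen[of k "Suc k", simplified]
    by (auto elim!: oddE)
qed

lemma rad_shift: "rad k (t + rad k t / 2 ^ Suc k) = - rad k t"
  using dcell_Suc_shift[of k t] by (auto simp: rad_def split: if_splits)

lemma half_swap_same: "half_swap j k x $ j = x $ j + rad k (x $ j) / 2 ^ Suc k"
  by (simp add: half_swap_def axis_def)

lemma half_swap_other [simp]: "i \<noteq> j \<Longrightarrow> half_swap j k x $ i = x $ i"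
  by (simp add: half_swap_def axis_def)

lemma rad_half_swap [simp]: "rad k (half_swap j k x $ j) = - rad k (x $ j)"
  by (simp add: half_swap_same rad_shift del: power_Suc)

lemma dcell_half_swap: "l \<le> k \<Longrightarrow> dcell l (half_swap j k x $ i) = dcell l (x $ i)"
  by (cases "i = j") (simp_all add: half_swap_same dcell_shift del: power_Suc)

lemma half_swap_in_cube [simp]: "half_swap j k x \<in> dyadic_cube \<longleftrightarrow> x \<in> dyadic_cube"
  by (simp add: dyadic_cube_def dcell_half_swap)

lemma half_swap_involution [simp]: "half_swap j k (half_swap j k x) = x"
proof -
  have "half_swap j k (half_swap j k x) $ i = x $ i" for i
  proof (cases "i = j")
    case True
    then show ?thesis
      by (simp only: half_swap_same[of j k "half_swap j k x"] rad_half_swap) 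
         (simp add: half_swap_same)
  qed simp
  then show ?thesis by (simp add: vec_eq_iff)
qed

lemma measurable_coord [measurable]: "(\<lambda>x::real^3. x $ j) \<in> borel_measurable borel"
  by (intro borel_measurable_continuous_onI continuous_intros)

lemma measurable_dcell [measurable]: "dcell k \<in> borel \<rightarrow>\<^sub>M count_space UNIV"
  unfolding dcell_def by measurable

lemma measurable_rad [measurable]: "rad k \<in> borel_measurable borel"
  unfolding rad_def by measurable

lemma axis_measurable [measurable]: "(\<lambda>t. axis j t :: real^3) \<in> borel_measurable borel"
proof -
  have *: "(\<lambda>t. axis j t :: real^3) = (\<lambda>t. t *\<^sub>R axis j 1)"
    by (simp add: fun_eq_iff vec_eq_iff axis_def)
  show ?thesis by (subst *) measurable
qed

lemma measurable_half_swap [measurable]: "half_swap j k \<in> borel \<rightarrow>\<^sub>M borel"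
  unfolding half_swap_def by measurable

lemma dyadic_cube_sets [measurable]: "dyadic_cube \<in> sets borel"
  unfolding dyadic_cube_def by measurable

text \<open>On the union \<open>Ev\<close> of all left halves the map is translation by
  \<open>e\<close>, on the union \<open>Od\<close> of all right halves translation by
  \<open>- e\<close>, and it exchanges the two sets. The preimage of \<open>A\<close> is thus a
  disjoint union of translates of \<open>A \<inter> Od\<close> and
  \<open>A \<inter> Ev\<close>.\<close>

lemma distr_half_swap: "distr lborel borel (half_swap j k) = lborel"
proof (rule measure_eqI)
  fix A :: "(real ^ 3) set"
  assume "A \<in> sets (distr lborel borel (half_swap j k))"
  then have [measurable]: "A \<in> sets borel" by simp
  define Ev Od where "Ev = {x::real^3. even (dcell (Suc k) (x $ j))}"
    and "Od = {x::real^3. odd (dcell (Suc k) (x $ j))}"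
  define e :: "real^3" where "e = axis j (1 / 2 ^ Suc k)"
  have [measurable]: "Ev \<in> sets borel" "Od \<in> sets borel"
    unfolding Ev_def Od_def by measurable
  have trans: "emeasure lborel ((+) c -` X) = emeasure lborel X" if [measurable]: "X \<in> sets borel"
    for c :: "real^3" and X
  proof -
    have "emeasure lborel X = emeasure (distr lborel borel ((+) c)) X"
      by (simp add: lborel_distr_plus)
    also have "\<dots> = emeasure lborel ((+) c -` X)"
      by (subst emeasure_distr) auto
    finally show ?thesis by simp
  qed
  have rE: "rad k (x $ j) = 1 \<longleftrightarrow> x \<in> Ev" "rad k (x $ j) = -1 \<longleftrightarrow> x \<in> Od" for x
    by (auto simp: Ev_def Od_def rad_def)
  have swE: "half_swap j k x = e + x" if "x \<in> Ev" for x
    using that rE(1)[of x] by (simp add: half_swap_def e_def)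
  have swO: "half_swap j k x = - e + x" if "x \<in> Od" for x
    using that rE(2)[of x] by (simp add: half_swap_def e_def vec_eq_iff axis_def)
  have EO: "half_swap j k x \<in> Ev \<longleftrightarrow> x \<in> Od" "half_swap j k x \<in> Od \<longleftrightarrow> x \<in> Ev" for x
    using rE[of x] rE[of "half_swap j k x"] by (auto simp: Ev_def Od_def)
  have "half_swap j k -` A = (half_swap j k -` A \<inter> Ev) \<union> (half_swap j k -` A \<inter> Od)"
    by (auto simp: Ev_def Od_def)
  moreover have "half_swap j k -` A \<inter> Ev = (+) e -` (A \<inter> Od)"
  proof (intro set_eqI iffI)
    fix x assume "x \<in> (+) e -` (A \<inter> Od)"
    then have y: "e + x \<in> A" "e + x \<in> Od" by auto
    have "half_swap j k (e + x) = x" using swO[OF y(2)] by simp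
    then show "x \<in> half_swap j k -` A \<inter> Ev"
      using y EO by (metis IntI half_swap_involution vimageI)
  qed (use swE EO in \<open>metis IntE IntI vimageD vimageI\<close>)
  moreover have "half_swap j k -` A \<inter> Od = (+) (- e) -` (A \<inter> Ev)"
  proof (intro set_eqI iffI)
    fix x assume "x \<in> (+) (- e) -` (A \<inter> Ev)"
    then have y: "- e + x \<in> A" "- e + x \<in> Ev" by auto
    have "half_swap j k (- e + x) = x" using swE[OF y(2)] by simp
    then show "x \<in> half_swap j k -` A \<inter> Od"
      using y EO by (metis IntI half_swap_involution vimageI)
  qed (use swO EO in \<open>metis IntE IntI vimageD vimageI\<close>)
  ultimately have 1: "half_swap j k -` A = (+) e -` (A \<inter> Od) \<union> (+) (- e) -` (A \<inter> Ev)"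
    and 2: "((+) e -` (A \<inter> Od)) \<inter> ((+) (- e) -` (A \<inter> Ev)) = {}"
    by (auto simp: Ev_def Od_def)
  have m: "(+) c -` X \<in> sets lborel" if "X \<in> sets borel" for c :: "real^3" and X
    using measurable_sets[of "(+) c" borel borel X] that by simp
  have s: "A \<inter> Od \<in> sets borel" "A \<inter> Ev \<in> sets borel" by measurable
  have "emeasure lborel (half_swap j k -` A) = emeasure lborel (A \<inter> Od) + emeasure lborel (A \<inter> Ev)"
    unfolding 1 by (subst plus_emeasure[OF m[OF s(1)] m[OF s(2)] 2, symmetric]) (simp only: trans s)
  also have "\<dots> = emeasure lborel A"
    by (subst plus_emeasure) (auto simp: Ev_def Od_def intro!: arg_cong[where f="emeasure lborel"])
  finally show "emeasure (distr lborel borel (half_swap j k)) A = emeasure lborel A"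
    by (subst emeasure_distr) auto
qed simp

section \<open>Lebesgue measure on the half-open cube and integrals against Rademacher
  functions\<close>

lemma space_cube_measure [simp]: "space cube_measure = dyadic_cube"
  by (simp add: cube_measure_def space_restrict_space)

lemma measurable_cube_measure [measurable (raw)]:
  "f \<in> borel \<rightarrow>\<^sub>M N \<Longrightarrow> f \<in> cube_measure \<rightarrow>\<^sub>M N"
  unfolding cube_measure_def by (intro measurable_restrict_space1) simp

lemma integral_cube_measure:
  fixes f :: "real ^ 3 \<Rightarrow> real"
  shows "integral\<^sup>L cube_measure f = (\<integral>x. indicator dyadic_cube x * f x \<partial>lborel)"
  unfolding cube_measure_def by (subst integral_restrict_space) simp_all

lemma nn_integral_cube_measure:
  "integral\<^sup>N cube_measure f = (\<integral>\<^sup>+x. f x * indicator dyadic_cube x \<partial>lborel)"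
  unfolding cube_measure_def by (subst nn_integral_restrict_space) simp_all

lemma dyadic_cube_iff: "x \<in> dyadic_cube \<longleftrightarrow> (\<forall>j. 0 \<le> x $ j \<and> x $ j < 1)"
  by (auto simp: dyadic_cube_def dcell_def floor_eq_iff)

lemma dyadic_cube_subset: "dyadic_cube \<subseteq> unit_cube"
  by (auto simp: dyadic_cube_iff unit_cube_def less_imp_le)

lemma unit_cube_eq_cbox: "unit_cube = cbox 0 1"
  by (auto simp: unit_cube_def mem_box_cart)

lemma prod_Basis_cart:
  fixes x :: "real ^ 'n"
  shows "(\<Prod>b\<in>Basis. x \<bullet> b) = (\<Prod>i\<in>UNIV. x $ i)"
proof -
  have *: "Basis = range (\<lambda>i. axis i 1 :: real ^ 'n)"
    by (auto simp: Basis_vec_def)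
  have "inj (\<lambda>i. axis i 1 :: real ^ 'n)"
    by (simp add: inj_def axis_eq_axis)
  then show ?thesis
    unfolding * by (subst prod.reindex) (simp_all add: inner_axis)
qed

lemma
  fixes a b :: "real ^ 'n"
  assumes "\<And>i. a $ i \<le> b $ i"
  shows emeasure_lborel_cbox_cart: "emeasure lborel (cbox a b) = ennreal (\<Prod>i\<in>UNIV. b $ i - a $ i)"
    and emeasure_lborel_box_cart: "emeasure lborel (box a b) = ennreal (\<Prod>i\<in>UNIV. b $ i - a $ i)"
proof -
  have "a \<bullet> u \<le> b \<bullet> u" if "u \<in> Basis" for u
    using that assms by (auto simp: Basis_vec_def inner_axis)
  then show "emeasure lborel (cbox a b) = ennreal (\<Prod>i\<in>UNIV. b $ i - a $ i)"
    and "emeasure lborel (box a b) = ennreal (\<Prod>i\<in>UNIV. b $ i - a $ i)"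
    by (simp_all add: prod_Basis_cart flip: inner_diff_left)
qed

lemma emeasure_cube_measure_le: "emeasure cube_measure (space cube_measure) \<le> 1"
proof -
  have "emeasure lborel dyadic_cube \<le> emeasure lborel (cbox 0 (1::real^3))"
    using dyadic_cube_subset by (intro emeasure_mono) (auto simp: unit_cube_eq_cbox)
  also have "\<dots> = 1"
    by (simp add: emeasure_lborel_cbox_cart)
  finally show ?thesis
    by (simp add: cube_measure_def emeasure_restrict_space)
qed

interpretation cube: prob_space cube_measure
proof
  have "emeasure lborel (box 0 (1::real^3)) \<le> emeasure lborel dyadic_cube"
    by (intro emeasure_mono) (auto simp: dyadic_cube_iff mem_box_cart less_imp_le)
  then have "1 \<le> emeasure lborel dyadic_cube"
    by (simp add: emeasure_lborel_box_cart)
  then show "emeasure cube_measure (space cube_measure) = 1"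
    using emeasure_cube_measure_le by (simp add: cube_measure_def emeasure_restrict_space antisym)
qed

lemma integral_half_swap:
  fixes f :: "real ^ 3 \<Rightarrow> real"
  assumes [measurable]: "f \<in> borel_measurable borel"
  shows "(\<integral>x. f (half_swap j k x) \<partial>cube_measure) = integral\<^sup>L cube_measure f"
proof -
  have "integral\<^sup>L cube_measure f
      = (\<integral>x. indicator dyadic_cube x * f x \<partial>distr lborel borel (half_swap j k))"
    by (simp only: distr_half_swap integral_cube_measure)
  also have "\<dots> = (\<integral>x. indicator dyadic_cube x * f (half_swap j k x) \<partial>lborel)"
    by (subst integral_distr) (simp_all add: indicator_def)
  finally show ?thesis by (simp add: integral_cube_measure)
qed

lemma cube_integrable_bounded:
  fixes f :: "real ^ 3 \<Rightarrow> real"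
  assumes [measurable]: "f \<in> borel_measurable borel"
    and "\<And>x. x \<in> dyadic_cube \<Longrightarrow> \<bar>f x\<bar> \<le> B"
  shows "integrable cube_measure f"
  by (rule cube.integrable_const_bound[of _ B]) (auto intro!: AE_I2 assms(2))

text \<open>The half swap keeps \<open>W\<close> and reverses the sign of \<open>rad k\<close>, so
  the integral equals its own negative.\<close>

lemma integral_rad_zero:
  fixes W :: "real ^ 3 \<Rightarrow> real"
  assumes [measurable]: "W \<in> borel_measurable borel"
    and inv: "\<And>x. W (half_swap j k x) = W x"
  shows "(\<integral>x. rad k (x $ j) * W x \<partial>cube_measure) = 0"
  using integral_half_swap[of "\<lambda>x. rad k (x $ j) * W x" j k] by (simp add: inv)

text \<open>Since \<open>rad k\<close> squares to 1, the swap turns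
  \<open>x $ j * rad k (x $ j)\<close> into its negative minus \<open>1 / 2 ^ Suc k\<close>. Hence
  twice the integral is minus the integral of \<open>W\<close> over \<open>2 ^ Suc k\<close>, which
  explains the exponent \<open>k + 2\<close>.\<close>

lemma integral_coord_rad:
  fixes W :: "real ^ 3 \<Rightarrow> real"
  assumes [measurable]: "W \<in> borel_measurable borel"
    and inv: "\<And>x. W (half_swap j k x) = W x"
    and bound: "\<And>x. x \<in> dyadic_cube \<Longrightarrow> \<bar>W x\<bar> \<le> B"
  shows "(\<integral>x. x $ j * rad k (x $ j) * W x \<partial>cube_measure)
      = - (integral\<^sup>L cube_measure W / 2 ^ (k + 2))"
proof -
  let ?f = "\<lambda>x. x $ j * rad k (x $ j) * W x"
  have "\<bar>?f x\<bar> \<le> 1 * 1 * B" if "x \<in> dyadic_cube" for x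
    unfolding abs_mult abs_rad using that bound[OF that]
    by (intro mult_mono) (auto simp: dyadic_cube_iff less_imp_le)
  then have [simp]: "integrable cube_measure ?f"
    by (intro cube_integrable_bounded) auto
  have [simp]: "integrable cube_measure W"
    by (rule cube_integrable_bounded) (auto intro: bound)
  have "?f (half_swap j k x) = - ?f x - W x / 2 ^ Suc k" for x
  proof -
    have "?f (half_swap j k x) = (x $ j + rad k (x $ j) / 2 ^ Suc k) * (- rad k (x $ j)) * W x"
      by (simp only: inv rad_half_swap) (simp only: half_swap_same)
    also have "\<dots> = - ?f x - (rad k (x $ j) * rad k (x $ j)) * W x / 2 ^ Suc k"
      by (simp add: left_diff_distrib right_diff_distrib distrib_right mult.assoc del: power_Suc rad_square)
    finally show ?thesis by (simp only: rad_square mult_1)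
  qed
  then have "integral\<^sup>L cube_measure ?f = (\<integral>x. - ?f x - W x / 2 ^ Suc k \<partial>cube_measure)"
    using integral_half_swap[of ?f j k] by simp
  also have "\<dots> = - integral\<^sup>L cube_measure ?f - integral\<^sup>L cube_measure W / 2 ^ Suc k"
    by (subst Bochner_Integration.integral_diff) (simp_all del: power_Suc)
  finally show ?thesis by simp
qed

section \<open>Pairing the discrepancy function with a generalised Haar function\<close>

definition same_box :: "nat \<Rightarrow> nat \<Rightarrow> nat \<Rightarrow> real ^ 3 \<Rightarrow> real ^ 3 \<Rightarrow> bool" where
  "same_box r1 r2 r3 x y \<longleftrightarrow> dcell r1 (x $ 1) = dcell r1 (y $ 1) \<and>
     dcell r2 (x $ 2) = dcell r2 (y $ 2) \<and> dcell r3 (x $ 3) = dcell r3 (y $ 3)"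

text \<open>Multiplied by a function that is constant on the boxes of
  \<open>same_box r1 r2 r3\<close>, this is a linear combination of Haar functions of a single box
  shape.\<close>

definition rad3 :: "nat \<Rightarrow> nat \<Rightarrow> nat \<Rightarrow> real ^ 3 \<Rightarrow> real" where
  "rad3 r1 r2 r3 x = rad r1 (x $ 1) * rad r2 (x $ 2) * rad r3 (x $ 3)"

lemma abs_rad3 [simp]: "\<bar>rad3 r1 r2 r3 x\<bar> = 1"
  by (simp add: rad3_def abs_mult)

lemma measurable_rad3 [measurable]: "rad3 r1 r2 r3 \<in> borel_measurable borel"
  unfolding rad3_def by measurable

lemma measurable_same_box [measurable]: "Measurable.pred borel (\<lambda>x. same_box r1 r2 r3 x y)"
  unfolding same_box_def by measurable

lemma same_box_half_swap:
  "same_box r1 r2 r3 (half_swap 1 r1 x) x"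
  "same_box r1 r2 r3 (half_swap 2 r2 x) x"
  "same_box r1 r2 r3 (half_swap 3 r3 x) x"
  by (simp_all add: same_box_def dcell_half_swap)

lemma coord_bound:
  assumes "x \<in> dyadic_cube"
  shows "\<bar>x $ j\<bar> \<le> 1"
proof -
  have "0 \<le> x $ j" "x $ j < 1"
    using assms unfolding dyadic_cube_iff by blast+
  then show ?thesis by simp
qed

text \<open>Each coordinate is handled in turn by \<open>integral_coord_rad\<close>, the other
  factors being invariant under its half swap. The three steps give three minus signs and the extra
  exponent 6.\<close>

lemma integral_volume_rad3:
  fixes w :: "real ^ 3 \<Rightarrow> real"
  assumes [measurable]: "w \<in> borel_measurable borel"
    and cell: "\<And>x y. same_box r1 r2 r3 x y \<Longrightarrow> w x = w y"
    and bound: "\<And>x. \<bar>w x\<bar> \<le> B"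
  shows "(\<integral>x. (x $ 1 * x $ 2 * x $ 3) * (rad3 r1 r2 r3 x * w x) \<partial>cube_measure)
      = - (integral\<^sup>L cube_measure w / 2 ^ (r1 + r2 + r3 + 6))"
proof -
  note inv = same_box_half_swap[THEN cell]
  have B: "0 \<le> B" using bound[of 0] by simp
  let ?w3 = "\<lambda>x. x $ 3 * rad r3 (x $ 3) * w x"
  let ?w2 = "\<lambda>x. x $ 2 * rad r2 (x $ 2) * ?w3 x"
  have b3: "\<bar>?w3 x\<bar> \<le> B" if "x \<in> dyadic_cube" for x
    using mult_mono[OF coord_bound[OF that, of 3] bound[of x]] B by (simp add: abs_mult)
  have b2: "\<bar>?w2 x\<bar> \<le> B" if "x \<in> dyadic_cube" for x
    using mult_mono[OF coord_bound[OF that, of 2] b3[OF that]] B by (simp add: abs_mult)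
  have "(\<integral>x. (x $ 1 * x $ 2 * x $ 3) * (rad3 r1 r2 r3 x * w x) \<partial>cube_measure)
      = (\<integral>x. x $ 1 * rad r1 (x $ 1) * ?w2 x \<partial>cube_measure)"
    by (simp add: rad3_def mult_ac)
  also have "\<dots> = - (integral\<^sup>L cube_measure ?w2 / 2 ^ (r1 + 2))"
    by (intro integral_coord_rad[where B=B]) (auto simp: inv b2)
  also have "integral\<^sup>L cube_measure ?w2 = - (integral\<^sup>L cube_measure ?w3 / 2 ^ (r2 + 2))"
    by (intro integral_coord_rad[where B=B]) (auto simp: inv b3)
  also have "integral\<^sup>L cube_measure ?w3 = - (integral\<^sup>L cube_measure w / 2 ^ (r3 + 2))"
    by (intro integral_coord_rad[where B=B]) (auto simp: inv bound)
  finally show ?thesis by (simp add: power_add)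
qed

text \<open>The contribution of a single point \<open>p\<close> of the cube to the counting part of
  the discrepancy. In product form, a half swap in one coordinate touches one factor only.\<close>

definition below :: "real ^ 3 \<Rightarrow> real ^ 3 \<Rightarrow> real" where
  "below p x = of_bool (p $ 1 < x $ 1) * of_bool (p $ 2 < x $ 2) * of_bool (p $ 3 < x $ 3)"

lemma measurable_below [measurable]: "below p \<in> borel_measurable borel"
  unfolding below_def by measurable

lemma less_iff_dcell_less:
  assumes "dcell k s \<noteq> dcell k t"
  shows "s < t \<longleftrightarrow> dcell k s < dcell k t"
proof -
  have mono: "dcell k u \<le> dcell k v" if "u \<le> v" for u v
    using that unfolding dcell_def by (intro floor_mono mult_left_mono) simp_all
  show ?thesis
    using mono[of s t] mono[of t s] assms by linarith
qed

text \<open>Off the box of \<open>p\<close>, the cells of \<open>x\<close> and \<open>p\<close> differ in some coordinate; there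
  the counting function is constant on cells, so the Rademacher factor integrates to zero.\<close>

lemma integral_below_rad3:
  fixes w :: "real ^ 3 \<Rightarrow> real"
  assumes [measurable]: "w \<in> borel_measurable borel"
    and cell: "\<And>x y. same_box r1 r2 r3 x y \<Longrightarrow> w x = w y"
    and bound: "\<And>x. \<bar>w x\<bar> \<le> B"
    and vanish: "\<And>x. same_box r1 r2 r3 x p \<Longrightarrow> w x = 0"
  shows "(\<integral>x. below p x * (rad3 r1 r2 r3 x * w x) \<partial>cube_measure) = 0"
proof -
  note inv = same_box_half_swap[THEN cell]
  define q where "q = (\<lambda>k j (x::real^3). of_bool (dcell k (x $ j) = dcell k (p $ j)) :: real)"
  have [measurable]: "q k j \<in> borel_measurable borel" for k j
    unfolding q_def by measurable
  have q_swap: "q k i (half_swap j l x) = q k i x" if "i \<noteq> j" for k i j l x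
    using that by (simp add: q_def)
  have q_swap_same: "q k j (half_swap j k x) = q k j x" for k j x
    by (simp add: q_def dcell_half_swap)
  \<comment> \<open>Where the cells of \<open>p\<close> and \<open>x\<close> differ, their indices
    decide the comparison and the swap keeps these indices; where they agree, the factor
    \<open>1 - q k j x\<close> is zero.\<close>
  have lt_swap: "(1 - q k j x) * of_bool (p $ j < half_swap j k x $ j)
      = (1 - q k j x) * of_bool (p $ j < x $ j)" for k j x
  proof (cases "dcell k (p $ j) = dcell k (x $ j)")
    case False
    then show ?thesis
      using less_iff_dcell_less[of k "p $ j" "x $ j"]
        less_iff_dcell_less[of k "p $ j" "half_swap j k x $ j"]
      by (simp add: dcell_half_swap)
  qed (simp add: q_def)
  \<comment> \<open>The three functions split the complement of the box of \<open>p\<close> by the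
    first coordinate in which the cells differ, following
    \<open>1 = (1 - u) + u * (1 - v) + u * v * (1 - z) + u * v * z\<close>. Each omits the
    Rademacher factor of its own coordinate. The last summand is the box of \<open>p\<close>, where
    \<open>w\<close> vanishes.\<close>
  define W1 where "W1 = (\<lambda>x. ((1 - q r1 1 x) * of_bool (p $ 1 < x $ 1)) *
    (of_bool (p $ 2 < x $ 2) * of_bool (p $ 3 < x $ 3) * rad r2 (x $ 2) * rad r3 (x $ 3)) * w x)"
  define W2 where "W2 = (\<lambda>x. ((1 - q r2 2 x) * of_bool (p $ 2 < x $ 2)) *
    (q r1 1 x * of_bool (p $ 1 < x $ 1) * of_bool (p $ 3 < x $ 3) * rad r1 (x $ 1) * rad r3 (x $ 3)) * w x)"
  define W3 where "W3 = (\<lambda>x. ((1 - q r3 3 x) * of_bool (p $ 3 < x $ 3)) *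
    (q r1 1 x * q r2 2 x * of_bool (p $ 1 < x $ 1) * of_bool (p $ 2 < x $ 2) *
      rad r1 (x $ 1) * rad r2 (x $ 2)) * w x)"
  have [measurable]: "W1 \<in> borel_measurable borel" "W2 \<in> borel_measurable borel"
      "W3 \<in> borel_measurable borel"
    unfolding W1_def W2_def W3_def by measurable
  have "W1 (half_swap 1 r1 x) = W1 x" "W2 (half_swap 2 r2 x) = W2 x"
      "W3 (half_swap 3 r3 x) = W3 x" for x
    unfolding W1_def W2_def W3_def by (simp_all add: lt_swap q_swap q_swap_same inv)
  then have zero: "(\<integral>x. rad r1 (x $ 1) * W1 x \<partial>cube_measure) = 0"
      "(\<integral>x. rad r2 (x $ 2) * W2 x \<partial>cube_measure) = 0"
      "(\<integral>x. rad r3 (x $ 3) * W3 x \<partial>cube_measure) = 0"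
    by (auto intro!: integral_rad_zero)
  have q01: "\<bar>q k j x\<bar> \<le> 1" "\<bar>1 - q k j x\<bar> \<le> 1" for k j x
    by (simp_all add: q_def)
  have 01: "\<bar>of_bool b :: real\<bar> \<le> 1" for b
    by simp
  have "\<bar>W1 x\<bar> \<le> 1 * B" "\<bar>W2 x\<bar> \<le> 1 * B" "\<bar>W3 x\<bar> \<le> 1 * B" for x
    unfolding W1_def W2_def W3_def abs_mult abs_rad
    by (intro mult_mono bound mult_le_one q01 01 mult_nonneg_nonneg abs_ge_zero zero_le_one order_refl)+
  then have int: "integrable cube_measure (\<lambda>x. rad r1 (x $ 1) * W1 x)"
      "integrable cube_measure (\<lambda>x. rad r2 (x $ 2) * W2 x)"
      "integrable cube_measure (\<lambda>x. rad r3 (x $ 3) * W3 x)"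
    by (simp_all add: cube_integrable_bounded[where B=B] abs_mult)
  have "w x * (q r1 1 x * q r2 2 x * q r3 3 x) = 0" for x
    using vanish[of x] by (auto simp: q_def same_box_def)
  moreover have "below p x * (rad3 r1 r2 r3 x * w x)
      = rad r1 (x $ 1) * W1 x + rad r2 (x $ 2) * W2 x + rad r3 (x $ 3) * W3 x
        + below p x * rad3 r1 r2 r3 x * (w x * (q r1 1 x * q r2 2 x * q r3 3 x))" for x
  proof -
    have "rad r1 (x $ 1) * W1 x = below p x * (rad3 r1 r2 r3 x * w x) * (1 - q r1 1 x)"
      "rad r2 (x $ 2) * W2 x = below p x * (rad3 r1 r2 r3 x * w x) * (q r1 1 x * (1 - q r2 2 x))"
      "rad r3 (x $ 3) * W3 x = below p x * (rad3 r1 r2 r3 x * w x) * (q r1 1 x * q r2 2 x * (1 - q r3 3 x))"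
      by (simp_all only: W1_def W2_def W3_def below_def rad3_def mult_ac)
    moreover have "a * (b * c) = a * (b * c) * (1 - u) + a * (b * c) * (u * (1 - v))
        + a * (b * c) * (u * v * (1 - z)) + a * b * (c * (u * v * z))" for a b c u v z :: real
      by (simp add: algebra_simps)
    ultimately show ?thesis by presburger
  qed
  ultimately have "(\<integral>x. below p x * (rad3 r1 r2 r3 x * w x) \<partial>cube_measure)
      = (\<integral>x. rad r1 (x $ 1) * W1 x + rad r2 (x $ 2) * W2 x + rad r3 (x $ 3) * W3 x \<partial>cube_measure)"
    by (simp only: mult_zero_right add_0_right)
  also have "\<dots> = 0"
    using int zero by simp
  finally show ?thesis .
qed

section \<open>The discrepancy function in coordinates\<close>

lemma prod_3: "prod f (UNIV :: 3 set) = f 1 * f 2 * f 3"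
  unfolding UNIV_3 by (simp add: ac_simps)

text \<open>The truncation \<open>max 0\<close> covers points with a negative coordinate, whose box
  is empty. A formula valid on the whole space is what later yields Borel measurability of
  \<open>discrepancy P\<close>.\<close>

lemma measure_anchored_box:
  "measure lborel (anchored_box x) = max 0 (x $ 1) * max 0 (x $ 2) * max 0 (x $ 3)"
proof (cases "\<forall>j. 0 \<le> x $ j")
  case True
  have [measurable]: "anchored_box x \<in> sets borel"
    unfolding anchored_box_def by measurable
  have "emeasure lborel (anchored_box x) \<le> emeasure lborel (cbox 0 x)"
    by (intro emeasure_mono) (auto simp: anchored_box_def mem_box_cart less_imp_le)
  moreover have "emeasure lborel (box 0 x) \<le> emeasure lborel (anchored_box x)"
    by (intro emeasure_mono) (auto simp: anchored_box_def mem_box_cart less_imp_le)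
  ultimately have "emeasure lborel (anchored_box x) = ennreal (\<Prod>j\<in>UNIV. x $ j)"
    using True by (simp add: emeasure_lborel_cbox_cart emeasure_lborel_box_cart antisym)
  then show ?thesis
    using True by (simp add: measure_def prod_nonneg prod_3 max_absorb2)
next
  case False
  then obtain j where j: "x $ j < 0"
    by (auto simp: not_le)
  then have "anchored_box x = {}"
    unfolding anchored_box_def by (auto intro!: exI[of _ j])
  moreover have "max 0 (x $ 1) * max 0 (x $ 2) * max 0 (x $ 3) = 0"
    using j exhaust_3[of j] by (auto simp: max_def)
  ultimately show ?thesis by simp
qed

lemma discrepancy_eq:
  assumes "P \<subseteq> unit_cube" "finite P"
  shows "discrepancy P x
    = (\<Sum>p\<in>P. below p x) - real (card P) * (max 0 (x $ 1) * max 0 (x $ 2) * max 0 (x $ 3))"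
proof -
  have "P \<inter> anchored_box x = {p \<in> P. p $ 1 < x $ 1 \<and> p $ 2 < x $ 2 \<and> p $ 3 < x $ 3}"
    using assms(1) by (auto simp: anchored_box_def unit_cube_def forall_3)
  moreover have "below p x = of_bool (p $ 1 < x $ 1 \<and> p $ 2 < x $ 2 \<and> p $ 3 < x $ 3)" for p
    by (simp add: below_def)
  ultimately have "real (card (P \<inter> anchored_box x)) = (\<Sum>p\<in>P. below p x)"
    using assms(2) by (simp add: of_bool_def sum.If_cases Int_def)
  then show ?thesis
    by (simp add: discrepancy_def measure_anchored_box)
qed

lemma discrepancy_eq_unit_cube:
  assumes "P \<subseteq> unit_cube" "finite P" "x \<in> unit_cube"
  shows "discrepancy P x = (\<Sum>p\<in>P. below p x) - real (card P) * (x $ 1 * x $ 2 * x $ 3)"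
  using assms(3) by (simp add: discrepancy_eq[OF assms(1,2)] unit_cube_def)

lemma measurable_discrepancy:
  assumes "P \<subseteq> unit_cube" "finite P"
  shows "discrepancy P \<in> borel_measurable borel"
proof -
  have "(\<lambda>x. (\<Sum>p\<in>P. below p x)
      - real (card P) * (max 0 (x $ 1) * max 0 (x $ 2) * max 0 (x $ 3))) \<in> borel_measurable borel"
    by measurable
  then show ?thesis
    by (simp only: discrepancy_eq[OF assms, symmetric])
qed

text \<open>The counting part pairs to zero because \<open>w\<close> vanishes on every box
  containing a point of \<open>P\<close>. What remains is the volume term, whose minus sign cancels
  the one in \<open>integral_volume_rad3\<close>.\<close>

lemma integral_discrepancy_rad3:
  fixes w :: "real ^ 3 \<Rightarrow> real"
  assumes P: "P \<subseteq> unit_cube" "finite P"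
    and [measurable]: "w \<in> borel_measurable borel"
    and cell: "\<And>x y. same_box r1 r2 r3 x y \<Longrightarrow> w x = w y"
    and bound: "\<And>x. \<bar>w x\<bar> \<le> B"
    and vanish: "\<And>x p. p \<in> P \<Longrightarrow> same_box r1 r2 r3 x p \<Longrightarrow> w x = 0"
  shows "(\<integral>x. discrepancy P x * (rad3 r1 r2 r3 x * w x) \<partial>cube_measure)
      = real (card P) * integral\<^sup>L cube_measure w / 2 ^ (r1 + r2 + r3 + 6)"
proof -
  let ?h = "\<lambda>x. rad3 r1 r2 r3 x * w x"
  have "discrepancy P x * ?h x
      = (\<Sum>p\<in>P. below p x * ?h x) - real (card P) * ((x $ 1 * x $ 2 * x $ 3) * ?h x)"
    if "x \<in> dyadic_cube" for x
  proof -
    have "x \<in> unit_cube"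
      using that dyadic_cube_subset by blast
    from discrepancy_eq_unit_cube[OF P this] show ?thesis
      by (simp only: left_diff_distrib sum_distrib_right mult.assoc)
  qed
  then have "(\<integral>x. discrepancy P x * ?h x \<partial>cube_measure)
      = (\<integral>x. (\<Sum>p\<in>P. below p x * ?h x) - real (card P) * ((x $ 1 * x $ 2 * x $ 3) * ?h x) \<partial>cube_measure)"
    by (intro Bochner_Integration.integral_cong) auto
  moreover have "integrable cube_measure (\<lambda>x. below p x * ?h x)" for p
    using bound
    by (intro cube_integrable_bounded[where B=B]) (auto simp: abs_mult below_def intro: order_trans[OF abs_ge_zero])
  moreover have "integrable cube_measure (\<lambda>x. (x $ 1 * x $ 2 * x $ 3) * ?h x)"
  proof (intro cube_integrable_bounded[where B="1 * 1 * 1 * (1 * B)"])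
    fix x assume "x \<in> dyadic_cube"
    then show "\<bar>x $ 1 * x $ 2 * x $ 3 * ?h x\<bar> \<le> 1 * 1 * 1 * (1 * B)"
      unfolding abs_mult abs_rad3
      by (intro mult_mono bound coord_bound order_refl) simp_all
  qed simp
  ultimately show ?thesis
    using integral_volume_rad3[OF assms(3) cell bound, of r1 r2 r3]
      integral_below_rad3[OF assms(3) cell bound vanish, of r1 r2 r3]
    by simp
qed

section \<open>Riesz products\<close>

text \<open>Sorts the nonconstant monomials of the expanded product by their smallest index
  \<open>a\<close>.\<close>

lemma prod_one_plus_first:
  fixes z :: "nat \<Rightarrow> 'a :: comm_ring_1"
  shows "(\<Prod>j<l. 1 + z j) = 1 + (\<Sum>a<l. z a * (\<Prod>i\<in>{a<..<l}. 1 + z i))"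
proof (induction l)
  case (Suc l)
  have "(\<Prod>i\<in>{a<..<Suc l}. 1 + z i) = (\<Prod>i\<in>{a<..<l}. 1 + z i) * (1 + z l)" if "a < l" for a
  proof -
    have "{a<..<Suc l} = insert l {a<..<l}"
      using that by auto
    then show ?thesis by simp
  qed
  then have "(\<Sum>a<l. z a * (\<Prod>i\<in>{a<..<Suc l}. 1 + z i))
      = (\<Sum>a<l. z a * (\<Prod>i\<in>{a<..<l}. 1 + z i)) * (1 + z l)"
    unfolding sum_distrib_right by (intro sum.cong) (auto simp: mult.assoc)
  moreover have "{l<..<Suc l} = {}"
    by auto
  ultimately show ?case
    by (simp add: Suc.IH algebra_simps)
qed simp

text \<open>Sorts the monomials of degree at least two by their smallest index \<open>a\<close> and
  largest index \<open>b\<close>, leaving the full product over the indices strictly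
  between.\<close>

lemma prod_one_plus_first_last:
  fixes z :: "nat \<Rightarrow> 'a :: comm_ring_1"
  shows "(\<Prod>j<l. 1 + z j)
    = 1 + (\<Sum>j<l. z j) + (\<Sum>b<l. \<Sum>a<b. z a * (\<Prod>i\<in>{a<..<b}. 1 + z i) * z b)"
proof (induction l)
  case (Suc l)
  have "(\<Prod>j<Suc l. 1 + z j) = (\<Prod>j<l. 1 + z j) + (\<Prod>j<l. 1 + z j) * z l"
    by (simp add: algebra_simps)
  also have "(\<Prod>j<l. 1 + z j) * z l = z l + (\<Sum>a<l. z a * (\<Prod>i\<in>{a<..<l}. 1 + z i) * z l)"
    unfolding prod_one_plus_first by (simp add: algebra_simps sum_distrib_left)
  finally show ?case
    by (simp add: Suc.IH algebra_simps)
qed simp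

text \<open>An imaginary perturbation changes the modulus only to second order. So a product of
  \<open>n\<close> such factors stays bounded for \<open>t\<close> of order
  \<open>1 / sqrt n\<close>, which is why the Riesz product is complex.\<close>

lemma norm_one_plus_imaginary: "cmod (1 + \<i> * of_real t) \<le> exp (t\<^sup>2 / 2)"
proof -
  have "cmod (1 + \<i> * of_real t) = sqrt (1 + t\<^sup>2)"
    by (simp add: cmod_def)
  also have "\<dots> \<le> exp (t\<^sup>2 / 2)"
  proof (rule real_le_lsqrt)
    have "1 + t\<^sup>2 \<le> exp (t\<^sup>2)"
      by (rule exp_ge_add_one_self)
    also have "exp (t\<^sup>2) = (exp (t\<^sup>2 / 2))\<^sup>2"
      by (simp flip: exp_double)
    finally show "1 + t\<^sup>2 \<le> (exp (t\<^sup>2 / 2))\<^sup>2" .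
  qed simp_all
  finally show ?thesis .
qed

lemma exp_half_le_2: "exp (1 / 2) \<le> (2 :: real)"
proof (rule power2_le_imp_le)
  show "(exp (1 / 2))\<^sup>2 \<le> (2\<^sup>2 :: real)"
    using exp_le by (simp flip: exp_double)
qed simp

lemma norm_riesz_product_le:
  assumes "\<And>i. \<bar>t i\<bar> \<le> \<delta>" and "real (card A) * \<delta>\<^sup>2 \<le> 1"
  shows "cmod (\<Prod>i\<in>A. 1 + \<i> * of_real (t i)) \<le> 2"
proof -
  have "cmod (\<Prod>i\<in>A. 1 + \<i> * of_real (t i)) = (\<Prod>i\<in>A. cmod (1 + \<i> * of_real (t i)))"
    by (rule prod_norm[symmetric])
  also have "\<dots> \<le> (\<Prod>i\<in>A. exp (\<delta>\<^sup>2 / 2))"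
  proof (rule prod_mono)
    fix i
    have "(t i)\<^sup>2 \<le> \<delta>\<^sup>2"
      using assms(1)[of i] by (simp add: abs_le_square_iff[symmetric])
    then have "exp ((t i)\<^sup>2 / 2) \<le> exp (\<delta>\<^sup>2 / 2)"
      by simp
    then show "0 \<le> cmod (1 + \<i> * of_real (t i)) \<and> cmod (1 + \<i> * of_real (t i)) \<le> exp (\<delta>\<^sup>2 / 2)"
      using norm_one_plus_imaginary[of "t i"] by (auto intro: order_trans)
  qed
  also have "\<dots> = exp (real (card A) * \<delta>\<^sup>2 / 2)"
    by (simp add: exp_of_nat_mult[symmetric])
  also have "\<dots> \<le> exp (1 / 2)"
    using assms(2) by simp
  also note exp_half_le_2
  finally show ?thesis .
qed

section \<open>Empty boxes and Halasz's Riesz product\<close>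

definition empty_box :: "(real ^ 3) set \<Rightarrow> nat \<Rightarrow> nat \<Rightarrow> nat \<Rightarrow> real ^ 3 \<Rightarrow> real" where
  "empty_box P r1 r2 r3 x = of_bool (\<forall>p\<in>P. \<not> same_box r1 r2 r3 x p)"

text \<open>For \<open>j \<le> m\<close> the boxes all have volume \<open>1 / 2 ^ (k + m)\<close>.
  The factor \<open>rad k (x $ 1)\<close> is left out so that it enters the test function once, and
  not once per factor of the Riesz product.\<close>

definition planar_haar :: "(real ^ 3) set \<Rightarrow> nat \<Rightarrow> nat \<Rightarrow> nat \<Rightarrow> real ^ 3 \<Rightarrow> real" where
  "planar_haar P k m j x = rad j (x $ 2) * rad (m - j) (x $ 3) * empty_box P k j (m - j) x"

text \<open>Taking the imaginary part removes the constant 1 and all monomials of even degree, and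
  keeps the linear ones with coefficient \<open>\<delta>\<close>.\<close>

definition riesz :: "(real ^ 3) set \<Rightarrow> nat \<Rightarrow> nat \<Rightarrow> real \<Rightarrow> nat set \<Rightarrow> real ^ 3 \<Rightarrow> real" where
  "riesz P k m \<delta> A x = Im (\<Prod>j\<in>A. 1 + \<i> * of_real (\<delta> * planar_haar P k m j x))"

lemma empty_box_bounds: "0 \<le> empty_box P r1 r2 r3 x" "empty_box P r1 r2 r3 x \<le> 1"
  by (simp_all add: empty_box_def)

lemma abs_empty_box: "\<bar>empty_box P r1 r2 r3 x\<bar> \<le> 1"
  by (simp add: empty_box_def)

lemma abs_planar_haar: "\<bar>planar_haar P k m j x\<bar> \<le> 1"
  by (simp add: planar_haar_def abs_mult abs_empty_box)

lemma measurable_empty_box [measurable]: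
  assumes "finite P"
  shows "empty_box P r1 r2 r3 \<in> borel_measurable borel"
proof -
  have [measurable]: "Measurable.pred borel (\<lambda>x. \<forall>p\<in>P. \<not> same_box r1 r2 r3 x p)"
    using assms by measurable
  show ?thesis unfolding empty_box_def by measurable
qed

lemma measurable_planar_haar [measurable]:
  assumes [measurable]: "finite P"
  shows "planar_haar P k m j \<in> borel_measurable borel"
  unfolding planar_haar_def by measurable

lemma measurable_riesz [measurable]:
  assumes [measurable]: "finite P"
  shows "riesz P k m \<delta> A \<in> borel_measurable borel"
  unfolding riesz_def by measurable

lemma same_box_cong:
  assumes "same_box r1 r2 r3 x y" "s1 \<le> r1" "s2 \<le> r2" "s3 \<le> r3"
  shows "same_box s1 s2 s3 x p \<longleftrightarrow> same_box s1 s2 s3 y p"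
proof -
  have "dcell s1 (x $ 1) = dcell s1 (y $ 1)" "dcell s2 (x $ 2) = dcell s2 (y $ 2)"
      "dcell s3 (x $ 3) = dcell s3 (y $ 3)"
    using assms by (auto simp: same_box_def intro: dcell_eq_mono)
  then show ?thesis by (simp add: same_box_def)
qed

lemma empty_box_cong:
  assumes "same_box r1 r2 r3 x y" "s1 \<le> r1" "s2 \<le> r2" "s3 \<le> r3"
  shows "empty_box P s1 s2 s3 x = empty_box P s1 s2 s3 y"
  using same_box_cong[OF assms] by (simp add: empty_box_def)

lemma empty_box_eq_0:
  assumes "p \<in> P" "same_box r1 r2 r3 x p" "s1 \<le> r1" "s2 \<le> r2" "s3 \<le> r3"
  shows "empty_box P s1 s2 s3 x = 0"
proof -
  have "same_box s1 s2 s3 x p"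
    using same_box_cong[OF assms(2-5), of p] by (simp add: same_box_def)
  then show ?thesis using assms(1) by (auto simp: empty_box_def)
qed

text \<open>The inequalities are strict because \<open>rad j\<close> is determined by the cell of
  level \<open>j + 1\<close>, not by that of level \<open>j\<close>.\<close>

lemma planar_haar_cong:
  assumes "same_box k r2 r3 x y" "j < r2" "m - j < r3"
  shows "planar_haar P k m j x = planar_haar P k m j y"
proof -
  have "rad j (x $ 2) = rad j (y $ 2)" "rad (m - j) (x $ 3) = rad (m - j) (y $ 3)"
    using assms by (auto simp: same_box_def intro: rad_cong)
  moreover have "empty_box P k j (m - j) x = empty_box P k j (m - j) y"
    using assms by (intro empty_box_cong) auto
  ultimately show ?thesis by (simp add: planar_haar_def)
qed

lemma riesz_cong:
  assumes "same_box k b (m - a) x y" "b \<le> m"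
  shows "riesz P k m \<delta> {a<..<b} x = riesz P k m \<delta> {a<..<b} y"
proof -
  have "planar_haar P k m j x = planar_haar P k m j y" if "j \<in> {a<..<b}" for j
    using that assms by (intro planar_haar_cong) auto
  then show ?thesis
    unfolding riesz_def by (intro arg_cong[of _ _ Im] prod.cong) auto
qed

lemma abs_riesz_le:
  assumes "0 \<le> \<delta>" "real (card A) * \<delta>\<^sup>2 \<le> 1"
  shows "\<bar>riesz P k m \<delta> A x\<bar> \<le> 2"
proof -
  have "\<bar>\<delta> * planar_haar P k m j x\<bar> \<le> \<delta>" for j
    using mult_left_mono[OF abs_planar_haar assms(1)] assms(1) by (simp add: abs_mult)
  from norm_riesz_product_le[of "\<lambda>j. \<delta> * planar_haar P k m j x", OF this assms(2)]
  show ?thesis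
    unfolding riesz_def by (rule order_trans[OF abs_Im_le_cmod])
qed

text \<open>Isolates the linear terms, which produce the lower bound. In the others the outermost
  factors contribute \<open>\<i> * \<i> = -1\<close>, and the imaginary part of the middle product
  is again a Riesz product, hence bounded.\<close>

lemma riesz_expansion:
  "riesz P k m \<delta> {..<l} x = \<delta> * (\<Sum>j<l. planar_haar P k m j x)
    - \<delta>\<^sup>2 * (\<Sum>b<l. \<Sum>a<b. planar_haar P k m a x * planar_haar P k m b x * riesz P k m \<delta> {a<..<b} x)"
proof -
  let ?g = "\<lambda>j. planar_haar P k m j x"
  let ?z = "\<lambda>j. \<i> * of_real (\<delta> * ?g j)"
  have Im_mult: "Im ((\<i> * of_real s) * w * (\<i> * of_real t)) = - (s * t * Im w)" for s t w
    by simp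
  have Im_z: "Im (\<i> * of_real s) = s" for s
    by simp
  have rearrange: "\<delta> * u * (\<delta> * v) * w = \<delta>\<^sup>2 * (u * v * w)" for u v w :: real
    by (simp add: power2_eq_square)
  have "riesz P k m \<delta> {..<l} x = (\<Sum>j<l. \<delta> * ?g j)
      + (\<Sum>b<l. \<Sum>a<b. - (\<delta> * ?g a * (\<delta> * ?g b) * riesz P k m \<delta> {a<..<b} x))"
    unfolding riesz_def prod_one_plus_first_last[of ?z] plus_complex.sel Im_sum Im_mult Im_z by simp
  then show ?thesis
    unfolding rearrange sum_negf sum_distrib_left by simp
qed

section \<open>Lower bound for the pairing with one Riesz product\<close>

lemma integral_same_box_le:
  "(\<integral>x. of_bool (same_box r1 r2 r3 x p) \<partial>cube_measure) \<le> (1 :: real) / 2 ^ (r1 + r2 + r3)"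
proof -
  let ?r = "\<lambda>j::3. if j = 1 then r1 else if j = 2 then r2 else r3"
  define a b :: "real ^ 3" where "a = (\<chi> j. dcell (?r j) (p $ j) / 2 ^ ?r j)"
    and "b = (\<chi> j. (dcell (?r j) (p $ j) + 1) / 2 ^ ?r j)"
  define S where "S = {x. same_box r1 r2 r3 x p}"
  have [measurable]: "S \<in> sets borel"
    unfolding S_def by measurable
  have between: "c / 2 ^ k \<le> t \<and> t \<le> (c + 1) / 2 ^ k" if "dcell k t = c" for c k and t :: real
  proof -
    have "of_int c \<le> 2 ^ k * t \<and> 2 ^ k * t < of_int c + 1"
      using that by (auto simp: dcell_def floor_eq_iff)
    then show ?thesis
      by (simp add: field_simps)
  qed
  have "S \<subseteq> cbox a b"
    by (auto simp: S_def same_box_def mem_box_cart a_def b_def forall_3 dest: between)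
  then have "emeasure lborel S \<le> emeasure lborel (cbox a b)"
    by (intro emeasure_mono) auto
  also have "\<dots> = ennreal (\<Prod>j\<in>UNIV. b $ j - a $ j)"
    by (intro emeasure_lborel_cbox_cart) (auto simp: a_def b_def divide_right_mono)
  also have "(\<Prod>j\<in>UNIV. b $ j - a $ j) = 1 / 2 ^ (r1 + r2 + r3)"
    by (simp add: prod_3 a_def b_def power_add flip: diff_divide_distrib)
  finally have S: "emeasure lborel S \<le> ennreal (1 / 2 ^ (r1 + r2 + r3))" .
  have "emeasure cube_measure (S \<inter> dyadic_cube) = emeasure lborel (S \<inter> dyadic_cube)"
    by (simp add: cube_measure_def emeasure_restrict_space Int_assoc)
  also have "\<dots> \<le> emeasure lborel S"
    by (intro emeasure_mono) auto
  finally have "measure cube_measure (S \<inter> dyadic_cube) \<le> 1 / 2 ^ (r1 + r2 + r3)"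
    using S unfolding measure_def
    by (intro enn2real_leI) (auto intro: order_trans)
  moreover have "(\<integral>x. (of_bool (same_box r1 r2 r3 x p) :: real) \<partial>cube_measure)
      = (\<integral>x. indicator (S \<inter> dyadic_cube) x \<partial>cube_measure)"
    by (intro Bochner_Integration.integral_cong) (auto simp: S_def indicator_def)
  ultimately show ?thesis
    by (simp add: Int_absorb2)
qed

text \<open>Union bound: the boxes that contain a point of \<open>P\<close> have total volume at
  most \<open>card P / 2 ^ (r1 + r2 + r3)\<close>, which is at most one half.\<close>

lemma integral_empty_box_ge:
  assumes "finite P" and card: "2 * real (card P) \<le> 2 ^ (r1 + r2 + r3)"
  shows "1 / 2 \<le> integral\<^sup>L cube_measure (empty_box P r1 r2 r3)"
proof -
  note [measurable] = measurable_empty_box[OF assms(1)]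
  let ?s = "\<lambda>p x. of_bool (same_box r1 r2 r3 x p) :: real"
  have int_s: "integrable cube_measure (?s p)" for p
    by (rule cube_integrable_bounded[where B=1]) auto
  have "1 / 2 \<le> 1 - real (card P) * (1 / 2 ^ (r1 + r2 + r3))"
    using card by (simp add: field_simps)
  also have "\<dots> \<le> 1 - (\<Sum>p\<in>P. integral\<^sup>L cube_measure (?s p))"
    by (intro diff_left_mono sum_bounded_above integral_same_box_le)
  also have "\<dots> = (\<integral>x. 1 - (\<Sum>p\<in>P. ?s p x) \<partial>cube_measure)"
    using int_s cube.prob_space by simp
  also have "\<dots> \<le> integral\<^sup>L cube_measure (empty_box P r1 r2 r3)"
  proof (rule integral_mono)
    show "integrable cube_measure (\<lambda>x. 1 - (\<Sum>p\<in>P. ?s p x))"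
      using int_s by simp
    show "integrable cube_measure (empty_box P r1 r2 r3)"
      by (rule cube_integrable_bounded[where B=1]) (auto simp: abs_empty_box)
    fix x
    show "1 - (\<Sum>p\<in>P. ?s p x) \<le> empty_box P r1 r2 r3 x"
    proof (cases "\<exists>p\<in>P. same_box r1 r2 r3 x p")
      case True
      then obtain p where "p \<in> P" "same_box r1 r2 r3 x p" by blast
      then have "1 \<le> (\<Sum>p\<in>P. ?s p x)"
        using member_le_sum[of p P "\<lambda>p. ?s p x"] assms(1) by simp
      then show ?thesis
        using empty_box_bounds(1)[of P r1 r2 r3 x] by linarith
    next
      case False
      then have "empty_box P r1 r2 r3 x = 1"
        by (auto simp: empty_box_def)
      then show ?thesis
        by (simp add: sum_nonneg)
    qed
  qed
  finally show ?thesis .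
qed

text \<open>Used to bound the total of all pair terms with last index \<open>b\<close> independently
  of \<open>b\<close>.\<close>

lemma sum_geometric_le_1: "(\<Sum>a<b. 1 / 2 ^ (b - a)) \<le> (1 :: real)"
proof -
  have "(\<Sum>a<b. 1 / 2 ^ (b - a)) = 1 - (1 / 2 ^ b :: real)"
  proof (induction b)
    case (Suc b)
    have "(\<Sum>a<Suc b. 1 / 2 ^ (Suc b - a)) = (\<Sum>a<b. 1 / 2 ^ (b - a)) / 2 + (1 / 2 :: real)"
      by (simp add: Suc_diff_le sum_divide_distrib mult.commute)
    then show ?case
      by (simp add: Suc.IH field_simps)
  qed simp
  then show ?thesis by simp
qed

lemma discrepancy_bounded:
  assumes "P \<subseteq> unit_cube" "finite P" "x \<in> unit_cube"
  shows "\<bar>discrepancy P x\<bar> \<le> real (card P)"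
proof -
  have x: "0 \<le> x $ j" "x $ j \<le> 1" for j
    using assms(3) by (auto simp: unit_cube_def)
  have "0 \<le> below p x" "below p x \<le> 1" for p
    by (auto simp: below_def)
  then have "0 \<le> (\<Sum>p\<in>P. below p x)" "(\<Sum>p\<in>P. below p x) \<le> real (card P)"
    using sum_bounded_above[of P "\<lambda>p. below p x" 1] by (auto intro: sum_nonneg)
  moreover have "0 \<le> x $ 1 * x $ 2 * x $ 3" "x $ 1 * x $ 2 * x $ 3 \<le> 1"
    using x by (auto intro!: mult_le_one)
  then have "0 \<le> real (card P) * (x $ 1 * x $ 2 * x $ 3)"
      "real (card P) * (x $ 1 * x $ 2 * x $ 3) \<le> real (card P)"
    by (auto intro: mult_left_le)
  ultimately show ?thesis
    unfolding discrepancy_eq_unit_cube[OF assms] by linarith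
qed

lemma cube_integrable_discrepancy_mult:
  assumes P: "P \<subseteq> unit_cube" "finite P" and [measurable]: "f \<in> borel_measurable borel"
    and bound: "\<And>x. x \<in> dyadic_cube \<Longrightarrow> \<bar>f x\<bar> \<le> B"
  shows "integrable cube_measure (\<lambda>x. discrepancy P x * f x)"
proof (rule cube_integrable_bounded)
  note [measurable] = measurable_discrepancy[OF P]
  show "(\<lambda>x. discrepancy P x * f x) \<in> borel_measurable borel"
    by measurable
  fix x assume x: "x \<in> dyadic_cube"
  then have "\<bar>discrepancy P x\<bar> \<le> real (card P)"
    using discrepancy_bounded[OF P] dyadic_cube_subset by blast
  then show "\<bar>discrepancy P x * f x\<bar> \<le> real (card P) * B"
    using bound[OF x] unfolding abs_mult by (intro mult_mono) auto
qed

text \<open>\<open>integral_discrepancy_rad3\<close> supplies the exponent \<open>k + m + 6\<close>;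
  the empty boxes fill at least half of the cube, which costs one more factor 2.\<close>

lemma discrepancy_planar_haar_ge:
  assumes P: "P \<subseteq> unit_cube" "finite P" and card: "2 * real (card P) \<le> 2 ^ (k + m)" and "j \<le> m"
  shows "real (card P) / 2 ^ (k + m + 7)
    \<le> (\<integral>x. discrepancy P x * (rad k (x $ 1) * planar_haar P k m j x) \<partial>cube_measure)"
proof -
  note [measurable] = measurable_empty_box[OF P(2)]
  have sum: "k + j + (m - j) = k + m"
    using \<open>j \<le> m\<close> by simp
  have "(\<integral>x. discrepancy P x * (rad k (x $ 1) * planar_haar P k m j x) \<partial>cube_measure)
      = (\<integral>x. discrepancy P x * (rad3 k j (m - j) x * empty_box P k j (m - j) x) \<partial>cube_measure)"
    by (simp add: planar_haar_def rad3_def mult.assoc)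
  also have "\<dots> = real (card P) * integral\<^sup>L cube_measure (empty_box P k j (m - j))
      / 2 ^ (k + j + (m - j) + 6)"
    by (intro integral_discrepancy_rad3[OF P, where B=1])
      (auto simp: abs_empty_box intro: empty_box_cong empty_box_eq_0)
  also have "\<dots> \<ge> real (card P) * (1 / 2) / 2 ^ (k + j + (m - j) + 6)"
    using integral_empty_box_ge[OF P(2), of k j "m - j"] card sum
    by (intro divide_right_mono mult_left_mono) auto
  finally show ?thesis
    unfolding sum by (simp add: power_add)
qed

text \<open>Since \<open>a < b\<close>, the factor with index \<open>b\<close> is the finest one in the second coordinate
  and the factor with index \<open>a\<close> the finest one in the third; all the others are constant on
  the boxes of side lengths \<open>2\<^sup>-\<^sup>k\<close>, \<open>2\<^sup>-\<^sup>b\<close>, \<open>2\<^sup>-\<^sup>(\<^sup>m\<^sup>-\<^sup>a\<^sup>)\<close>.\<close>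

lemma discrepancy_riesz_pair_le:
  assumes P: "P \<subseteq> unit_cube" "finite P"
    and ab: "a < b" "b \<le> m" and \<delta>: "0 \<le> \<delta>" "real (Suc m) * \<delta>\<^sup>2 \<le> 1"
  shows "(\<integral>x. discrepancy P x * (rad k (x $ 1) * (planar_haar P k m a x * planar_haar P k m b x
      * riesz P k m \<delta> {a<..<b} x)) \<partial>cube_measure)
    \<le> real (card P) / 2 ^ (k + m + 5) * (1 / 2 ^ (b - a))"
proof -
  note [measurable] = measurable_empty_box[OF P(2)] measurable_riesz[OF P(2)]
  \<comment> \<open>What is left of the product once the finest Rademacher factors,
    \<open>rad b\<close> in the second coordinate and \<open>rad (m - a)\<close> in the third, are
    taken out.\<close>
  define w where "w = (\<lambda>x. rad a (x $ 2) * rad (m - b) (x $ 3) * empty_box P k a (m - a) x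
    * empty_box P k b (m - b) x * riesz P k m \<delta> {a<..<b} x)"
  \<comment> \<open>The product of the two terms lives on boxes smaller than the original ones by
    the factor \<open>2 ^ (b - a)\<close>; this is the source of the geometric decay.\<close>
  have sum: "k + b + (m - a) = (k + m) + (b - a)"
    using ab by simp
  have "real (card {a<..<b}) * \<delta>\<^sup>2 \<le> real (Suc m) * \<delta>\<^sup>2"
    using ab by (intro mult_right_mono) auto
  then have riesz: "\<bar>riesz P k m \<delta> {a<..<b} x\<bar> \<le> 2" for x
    using \<delta> by (intro abs_riesz_le) auto
  have [measurable]: "w \<in> borel_measurable borel"
    unfolding w_def by measurable
  have w_bound: "\<bar>w x\<bar> \<le> 1 * 1 * 1 * 1 * 2" for x
    unfolding w_def abs_mult abs_rad
    by (intro mult_mono abs_empty_box riesz) auto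
  have w_cong: "w x = w y" if xy: "same_box k b (m - a) x y" for x y
  proof -
    have "rad a (x $ 2) = rad a (y $ 2)" "rad (m - b) (x $ 3) = rad (m - b) (y $ 3)"
      using xy ab by (auto simp: same_box_def intro: rad_cong)
    moreover have "empty_box P k a (m - a) x = empty_box P k a (m - a) y"
        "empty_box P k b (m - b) x = empty_box P k b (m - b) y"
      using xy ab by (auto intro!: empty_box_cong[OF xy])
    ultimately show ?thesis
      using riesz_cong[OF xy ab(2)] by (simp add: w_def)
  qed
  have w_0: "w x = 0" if "p \<in> P" "same_box k b (m - a) x p" for x p
    using empty_box_eq_0[OF that, of k a "m - a"] ab by (simp add: w_def)
  have "(\<integral>x. discrepancy P x * (rad k (x $ 1) * (planar_haar P k m a x * planar_haar P k m b x
      * riesz P k m \<delta> {a<..<b} x)) \<partial>cube_measure)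
    = (\<integral>x. discrepancy P x * (rad3 k b (m - a) x * w x) \<partial>cube_measure)"
    by (simp only: planar_haar_def rad3_def w_def mult_ac)
  also have "\<dots> = real (card P) * integral\<^sup>L cube_measure w / 2 ^ (k + b + (m - a) + 6)"
    using w_cong w_bound w_0 by (intro integral_discrepancy_rad3[OF P, where B="1 * 1 * 1 * 1 * 2"]) auto
  also have "\<dots> \<le> real (card P) * 2 / 2 ^ (k + b + (m - a) + 6)"
  proof -
    have "integral\<^sup>L cube_measure w \<le> (\<integral>x. 2 \<partial>cube_measure)"
      using w_bound by (intro integral_mono cube_integrable_bounded[where B=2]) (auto simp: abs_le_iff)
    also have "\<dots> = 2"
      using cube.prob_space by simp
    finally show ?thesis
      by (intro divide_right_mono mult_left_mono) auto
  qed
  finally show ?thesis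
    unfolding sum by (simp add: power_add)
qed

text \<open>Summed over all pairs, the correction has the size of the linear term times a constant
  multiple of \<open>\<delta>\<close>; the bound \<open>\<delta> \<le> 1 / 16\<close> keeps it below
  half of the linear term. The condition on \<open>real (Suc m) * \<delta>\<^sup>2\<close> bounds
  the middle products.\<close>

lemma discrepancy_riesz_ge:
  assumes P: "P \<subseteq> unit_cube" "finite P" and card: "2 * real (card P) \<le> 2 ^ (k + m)"
    and \<delta>: "0 \<le> \<delta>" "\<delta> \<le> 1 / 16" "real (Suc m) * \<delta>\<^sup>2 \<le> 1"
  shows "real (card P) / 2 ^ (k + m + 8) * (\<delta> * real (Suc m))
    \<le> (\<integral>x. discrepancy P x * (rad k (x $ 1) * riesz P k m \<delta> {..<Suc m} x) \<partial>cube_measure)"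
proof -
  note [measurable] = measurable_planar_haar[OF P(2)] measurable_riesz[OF P(2)]
  let ?D = "\<lambda>f x. discrepancy P x * (rad k (x $ 1) * f x)"
  let ?g = "\<lambda>j. planar_haar P k m j"
  let ?q = "\<lambda>a b x. ?g a x * ?g b x * riesz P k m \<delta> {a<..<b} x"
  let ?N = "real (card P)"
  have riesz: "\<bar>riesz P k m \<delta> {a<..<b} x\<bar> \<le> 2" if "b < Suc m" for a b x
  proof -
    have "real (card {a<..<b}) * \<delta>\<^sup>2 \<le> real (Suc m) * \<delta>\<^sup>2"
      using that by (intro mult_right_mono) auto
    then show ?thesis
      using \<delta> by (intro abs_riesz_le) auto
  qed
  have int_g: "integrable cube_measure (?D (?g j))" for j
    by (rule cube_integrable_discrepancy_mult[OF P, where B=1]) (auto simp: abs_mult abs_planar_haar)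
  have int_q: "integrable cube_measure (?D (?q a b))" if "b < Suc m" for a b
  proof (rule cube_integrable_discrepancy_mult[OF P])
    show "\<bar>rad k (x $ 1) * ?q a b x\<bar> \<le> 1 * (1 * 1 * 2)" for x
      unfolding abs_mult abs_rad
      by (intro mult_mono riesz abs_planar_haar that) auto
  qed measurable
  have "?D (riesz P k m \<delta> {..<Suc m}) x = \<delta> * (\<Sum>j<Suc m. ?D (?g j) x)
      - \<delta>\<^sup>2 * (\<Sum>b<Suc m. \<Sum>a<b. ?D (?q a b) x)" for x
    unfolding riesz_expansion right_diff_distrib sum_distrib_left by (simp only: mult_ac)
  then have "integral\<^sup>L cube_measure (?D (riesz P k m \<delta> {..<Suc m}))
      = (\<integral>x. \<delta> * (\<Sum>j<Suc m. ?D (?g j) x) - \<delta>\<^sup>2 * (\<Sum>b<Suc m. \<Sum>a<b. ?D (?q a b) x) \<partial>cube_measure)"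
    by presburger
  also have "\<dots> = \<delta> * (\<Sum>j<Suc m. integral\<^sup>L cube_measure (?D (?g j)))
      - \<delta>\<^sup>2 * (\<Sum>b<Suc m. \<Sum>a<b. integral\<^sup>L cube_measure (?D (?q a b)))"
  proof -
    let ?F = "\<lambda>x. \<Sum>j<Suc m. ?D (?g j) x"
    let ?G = "\<lambda>x. \<Sum>b<Suc m. \<Sum>a<b. ?D (?q a b) x"
    have F: "integrable cube_measure ?F"
      by (intro Bochner_Integration.integrable_sum int_g)
    have F_eq: "integral\<^sup>L cube_measure ?F = (\<Sum>j<Suc m. integral\<^sup>L cube_measure (?D (?g j)))"
      by (intro Bochner_Integration.integral_sum int_g)
    have G: "integrable cube_measure ?G"
      by (intro Bochner_Integration.integrable_sum int_q) simp
    have "integral\<^sup>L cube_measure ?G = (\<Sum>b<Suc m. \<integral>x. (\<Sum>a<b. ?D (?q a b) x) \<partial>cube_measure)"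
      by (intro Bochner_Integration.integral_sum Bochner_Integration.integrable_sum int_q) simp
    also have "\<dots> = (\<Sum>b<Suc m. \<Sum>a<b. integral\<^sup>L cube_measure (?D (?q a b)))"
      by (intro sum.cong refl Bochner_Integration.integral_sum int_q) simp
    finally have G_eq: "integral\<^sup>L cube_measure ?G
        = (\<Sum>b<Suc m. \<Sum>a<b. integral\<^sup>L cube_measure (?D (?q a b)))" .
    have "(\<integral>x. \<delta> * ?F x - \<delta>\<^sup>2 * ?G x \<partial>cube_measure)
        = (\<integral>x. \<delta> * ?F x \<partial>cube_measure) - (\<integral>x. \<delta>\<^sup>2 * ?G x \<partial>cube_measure)"
      by (intro Bochner_Integration.integral_diff integrable_mult_right F G)
    then show ?thesis
      by (simp only: integral_mult_right_zero F_eq G_eq)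
  qed
  also have "\<dots> \<ge> \<delta> * (\<Sum>j<Suc m. ?N / 2 ^ (k + m + 7))
      - \<delta>\<^sup>2 * (\<Sum>b<Suc m. \<Sum>a<b. ?N / 2 ^ (k + m + 5) * (1 / 2 ^ (b - a)))"
    using \<delta> by (intro diff_mono mult_left_mono sum_mono discrepancy_planar_haar_ge[OF P card]
        discrepancy_riesz_pair_le[OF P]) auto
  finally have lower: "\<delta> * (\<Sum>j<Suc m. ?N / 2 ^ (k + m + 7))
      - \<delta>\<^sup>2 * (\<Sum>b<Suc m. \<Sum>a<b. ?N / 2 ^ (k + m + 5) * (1 / 2 ^ (b - a)))
    \<le> integral\<^sup>L cube_measure (?D (riesz P k m \<delta> {..<Suc m}))" .
  have "\<delta>\<^sup>2 * (\<Sum>b<Suc m. \<Sum>a<b. ?N / 2 ^ (k + m + 5) * (1 / 2 ^ (b - a)))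
      \<le> \<delta>\<^sup>2 * (\<Sum>b<Suc m. ?N / 2 ^ (k + m + 5) * 1)"
    unfolding sum_distrib_left[symmetric]
    by (intro mult_left_mono sum_mono sum_geometric_le_1) auto
  also have "\<dots> = \<delta> * (8 * \<delta>) * (?N / 2 ^ (k + m + 8) * real (Suc m))"
    by (simp add: power_add power2_eq_square field_simps)
  also have "\<dots> \<le> \<delta> * 1 * (?N / 2 ^ (k + m + 8) * real (Suc m))"
    using \<delta> by (intro mult_right_mono mult_left_mono) auto
  finally have "\<delta>\<^sup>2 * (\<Sum>b<Suc m. \<Sum>a<b. ?N / 2 ^ (k + m + 5) * (1 / 2 ^ (b - a)))
      \<le> \<delta> * 1 * (?N / 2 ^ (k + m + 8) * real (Suc m))" .
  moreover have "\<delta> * (\<Sum>j<Suc m. ?N / 2 ^ (k + m + 7)) = 2 * (\<delta> * 1 * (?N / 2 ^ (k + m + 8) * real (Suc m)))"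
    by (simp add: power_add field_simps)
  ultimately have "\<delta> * 1 * (?N / 2 ^ (k + m + 8) * real (Suc m))
      \<le> integral\<^sup>L cube_measure (?D (riesz P k m \<delta> {..<Suc m}))"
    using lower by linarith
  then show ?thesis
    by (simp only: mult_1_right mult.left_commute)
qed

section \<open>Exponential square integrability\<close>

lemma cosh_le_exp_square: "(exp y + exp (- y)) / 2 \<le> exp (y\<^sup>2 / 2)" for y :: real
proof -
  have nonneg: "(exp y + exp (- y)) / 2 \<le> exp (y\<^sup>2 / 2)" if "0 \<le> y" for y :: real
  proof -
    have pos: "0 < 1 + exp (2 * y)"
      by (simp add: add_pos_pos)
    \<comment> \<open>The logarithmic estimate behind Hoeffding's lemma, for a fair coin with values
      0 and \<open>2 * y\<close>. Multiplying by \<open>exp (- y)\<close> below centres it; negative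
      \<open>y\<close> follow by symmetry.\<close>
    have "- (2 * y) * (1 / 2) + ln (1 + 1 / 2 * (exp (2 * y) - 1)) \<le> (2 * y)\<^sup>2 / 8"
      using that by (intro Hoeffdings_lemma_aux) auto
    then have "ln ((1 + exp (2 * y)) / 2) \<le> y\<^sup>2 / 2 + y"
      by (simp add: field_simps power2_eq_square)
    then have "exp (ln ((1 + exp (2 * y)) / 2)) \<le> exp (y\<^sup>2 / 2 + y)"
      by (simp only: exp_le_cancel_iff)
    then have "(1 + exp (2 * y)) / 2 \<le> exp (y\<^sup>2 / 2 + y)"
      using pos by simp
    then have "(1 + exp (2 * y)) / 2 * exp (- y) \<le> exp (y\<^sup>2 / 2 + y) * exp (- y)"
      by (rule mult_right_mono) simp
    moreover have "exp (2 * y) * exp (- y) = exp y" "exp (y\<^sup>2 / 2 + y) * exp (- y) = exp (y\<^sup>2 / 2)"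
      by (simp_all flip: exp_add)
    ultimately show ?thesis
      by (simp add: algebra_simps add_divide_distrib)
  qed
  show ?thesis
    using nonneg[of y] nonneg[of "- y"] by (cases "0 \<le> y") (auto simp: add.commute)
qed

text \<open>Expanding the squares leaves cross terms \<open>y\<close> and \<open>- y\<close>, whose
  exponentials average to at most \<open>exp (y\<^sup>2 / 2)\<close>. This adds at most
  \<open>8 / q\<^sup>2\<close> to the coefficient \<open>1 / q\<close> of \<open>s\<^sup>2\<close>,
  and \<open>(q + 8) * (q - 8) \<le> q\<^sup>2\<close> absorbs it into
  \<open>1 / (q - 8)\<close>.\<close>

lemma exp_square_average_le:
  fixes s c q :: real
  assumes q: "8 < q" and c: "\<bar>c\<bar> \<le> 2"
  shows "(exp ((s + c)\<^sup>2 / q) + exp ((s - c)\<^sup>2 / q)) / 2 \<le> exp (4 / q) * exp (s\<^sup>2 / (q - 8))"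
proof -
  define y where "y = 2 * s * c / q"
  have c2: "c\<^sup>2 \<le> 4"
    using power_mono[OF c, of 2] by simp
  have "(s + c)\<^sup>2 / q = (s\<^sup>2 + c\<^sup>2) / q + y" "(s - c)\<^sup>2 / q = (s\<^sup>2 + c\<^sup>2) / q + - y"
    unfolding y_def by (simp_all add: power2_sum power2_diff add_divide_distrib diff_divide_distrib)
  then have "(exp ((s + c)\<^sup>2 / q) + exp ((s - c)\<^sup>2 / q)) / 2
      = exp ((s\<^sup>2 + c\<^sup>2) / q) * ((exp y + exp (- y)) / 2)"
    by (simp only: exp_add) (simp add: algebra_simps add_divide_distrib)
  also have "\<dots> \<le> exp ((s\<^sup>2 + c\<^sup>2) / q) * exp (y\<^sup>2 / 2)"
    by (intro mult_left_mono cosh_le_exp_square) simp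
  also have "\<dots> = exp (c\<^sup>2 / q + s\<^sup>2 * (1 / q + 2 * c\<^sup>2 / q\<^sup>2))"
    using q by (simp add: y_def power_mult_distrib power_divide algebra_simps add_divide_distrib flip: exp_add)
  also have "\<dots> \<le> exp (4 / q + s\<^sup>2 * (1 / (q - 8)))"
  proof -
    have "1 / q + 2 * c\<^sup>2 / q\<^sup>2 \<le> 1 / q + 8 / q\<^sup>2"
      using c2 by (simp add: divide_right_mono)
    also have "\<dots> = (q + 8) / q\<^sup>2"
      using q by (simp add: power2_eq_square add_divide_distrib)
    also have "\<dots> \<le> 1 / (q - 8)"
      using q by (simp add: divide_simps) (simp add: power2_eq_square algebra_simps)
    finally have "s\<^sup>2 * (1 / q + 2 * c\<^sup>2 / q\<^sup>2) \<le> s\<^sup>2 * (1 / (q - 8))"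
      by (rule mult_left_mono) simp
    moreover have "c\<^sup>2 / q \<le> 4 / q"
      using c2 q by (simp add: divide_right_mono)
    ultimately show ?thesis by simp
  qed
  finally show ?thesis
    by (simp add: exp_add)
qed

text \<open>The denominator \<open>8 * (L + K)\<close> is chosen so that adding one more Rademacher term costs
  only a factor \<open>exp (1 / (2 * L))\<close>.\<close>

lemma integral_exp_square_martingale_le:
  fixes h :: "nat \<Rightarrow> real ^ 3 \<Rightarrow> real"
  assumes [measurable]: "\<And>k. h k \<in> borel_measurable borel"
    and bound: "\<And>k x. \<bar>h k x\<bar> \<le> 2"
    and inv: "\<And>k l x. k \<le> l \<Longrightarrow> h k (half_swap 1 l x) = h k x"
    and "0 < L"
  shows "(\<integral>x. exp ((\<Sum>k<K. rad k (x $ 1) * h k x)\<^sup>2 / (8 * real (L + K))) \<partial>cube_measure)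
    \<le> exp (real K / (2 * real L))"
proof (induction K)
  case 0
  show ?case using cube.prob_space by simp
next
  case (Suc K)
  define S where "S = (\<lambda>x. \<Sum>k<K. rad k (x $ 1) * h k x)"
  define q where "q = 8 * real (L + Suc K)"
  have [measurable]: "S \<in> borel_measurable borel"
    unfolding S_def by measurable
  have q: "8 < q" "q - 8 = 8 * real (L + K)"
    using \<open>0 < L\<close> by (auto simp: q_def)
  have "rad k (half_swap 1 K x $ 1) = rad k (x $ 1)" if "k < K" for k x
    using that by (intro rad_cong[of K]) (auto simp: dcell_half_swap)
  then have S_inv: "S (half_swap 1 K x) = S x" for x
    unfolding S_def by (intro sum.cong) (auto simp: inv)
  have S_bound: "\<bar>S x\<bar> \<le> real K * 2" for x
  proof -
    have "\<bar>S x\<bar> \<le> (\<Sum>k<K. \<bar>rad k (x $ 1) * h k x\<bar>)"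
      unfolding S_def by (rule sum_abs)
    also have "\<dots> \<le> real (card {..<K}) * 2"
      by (rule sum_bounded_above) (simp add: abs_mult bound)
    finally show ?thesis by simp
  qed
  let ?\<psi> = "\<lambda>x. exp ((S x + rad K (x $ 1) * h K x)\<^sup>2 / q)"
  let ?\<phi> = "\<lambda>x. exp ((S x - rad K (x $ 1) * h K x)\<^sup>2 / q)"
  have rh: "\<bar>rad K (x $ 1) * h K x\<bar> \<le> 2" for x
    by (simp add: abs_mult bound)
  have int_exp: "integrable cube_measure (\<lambda>x. exp ((f x)\<^sup>2 / c))"
    if [measurable]: "f \<in> borel_measurable borel" and f: "\<And>x. \<bar>f x\<bar> \<le> B" and "0 < c"
    for f :: "real ^ 3 \<Rightarrow> real" and B c
  proof (rule cube_integrable_bounded)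
    fix x
    have "(f x)\<^sup>2 \<le> B\<^sup>2"
      using power_mono[OF f[of x], of 2] by simp
    then show "\<bar>exp ((f x)\<^sup>2 / c)\<bar> \<le> exp (B\<^sup>2 / c)"
      using \<open>0 < c\<close> by (simp add: divide_right_mono)
  qed measurable
  have int: "integrable cube_measure ?\<psi>" "integrable cube_measure ?\<phi>"
    using q abs_triangle_ineq[THEN order_trans, OF add_mono[OF S_bound rh]]
      abs_triangle_ineq4[THEN order_trans, OF add_mono[OF S_bound rh]]
    by (auto intro!: int_exp[where B="real K * 2 + 2"])
  have int': "integrable cube_measure (\<lambda>x. exp ((S x)\<^sup>2 / (q - 8)))"
    using S_bound q by (intro int_exp[where B="real K * 2"]) auto
  \<comment> \<open>The swap at level \<open>K\<close> fixes \<open>S\<close> and \<open>h K\<close>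
    and reverses the sign of the newest term. Averaging over it replaces conditioning on the earlier
    levels.\<close>
  have "integral\<^sup>L cube_measure ?\<psi> = integral\<^sup>L cube_measure ?\<phi>"
    using integral_half_swap[of ?\<psi> 1 K] by (simp add: S_inv inv)
  then have "integral\<^sup>L cube_measure ?\<psi> = (\<integral>x. (?\<psi> x + ?\<phi> x) / 2 \<partial>cube_measure)"
    using int by simp
  also have "\<dots> \<le> (\<integral>x. exp (4 / q) * exp ((S x)\<^sup>2 / (q - 8)) \<partial>cube_measure)"
    using int int' by (intro integral_mono exp_square_average_le q rh) auto
  also have "\<dots> \<le> exp (4 / q) * exp (real K / (2 * real L))"
    using Suc.IH by (simp add: S_def q(2))
  \<comment> \<open>Here \<open>q \<ge> 8 * real L\<close>, so \<open>4 / q\<close> is at most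
    \<open>1 / (2 * real L)\<close>.\<close>
  also have "\<dots> \<le> exp (1 / (2 * real L)) * exp (real K / (2 * real L))"
    using \<open>0 < L\<close> by (intro mult_right_mono) (auto simp: q_def divide_simps)
  also have "\<dots> = exp (real (Suc K) / (2 * real L))"
    by (simp add: add_divide_distrib flip: exp_add)
  finally show ?case
    by (simp add: S_def q_def)
qed

section \<open>Orlicz duality\<close>

text \<open>Apply \<open>ln u \<le> u - 1\<close> to \<open>u = exp t / s\<close>, multiply by
  \<open>s\<close>, and enlarge \<open>ln s\<close> to \<open>ln (exp 1 + s)\<close>.\<close>

lemma young_exp_log:
  fixes s t :: real
  assumes "0 \<le> s"
  shows "s * t \<le> LlogL_young s + exp t"
proof (cases "s = 0")
  case False
  then have s: "0 < s" using assms by simp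
  have "ln (exp t / s) \<le> exp t / s - 1"
    using s by (intro ln_le_minus_one) simp
  then have "t - ln s \<le> exp t / s - 1"
    using s by (simp add: ln_div)
  then have "s * (t - ln s) \<le> s * (exp t / s - 1)"
    using s by (intro mult_left_mono) auto
  also have "\<dots> = exp t - s"
    using s by (simp add: right_diff_distrib)
  finally have "s * t \<le> s * ln s + exp t"
    using s by (simp add: right_diff_distrib)
  moreover have "s * ln s \<le> s * ln (exp 1 + s)"
    using s by (intro mult_left_mono) (auto simp: add_pos_pos)
  ultimately show ?thesis
    by (simp add: LlogL_young_def)
qed (simp add: LlogL_young_def)

lemma LlogL_young_nonneg: "0 \<le> t \<Longrightarrow> 0 \<le> LlogL_young t"
proof -
  assume "0 \<le> t"
  then have "1 \<le> exp 1 + t"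
    using one_le_exp_iff[of "1::real"] by linarith
  then show ?thesis
    using \<open>0 \<le> t\<close> by (simp add: LlogL_young_def)
qed

lemma LlogL_young_mono: "0 \<le> s \<Longrightarrow> s \<le> t \<Longrightarrow> LlogL_young s \<le> LlogL_young t"
proof -
  assume st: "0 \<le> s" "s \<le> t"
  have e: "1 \<le> exp (1::real)" by simp
  show ?thesis
    unfolding LlogL_young_def using st e by (intro mult_mono ln_mono ln_ge_zero) (linarith | simp)+
qed

text \<open>Turns a family of integrated pointwise inequalities into a Cauchy-Schwarz inequality.
  The choice \<open>\<mu> = Q / A\<close> gives the bound; if \<open>A\<close> were zero, a large
  \<open>\<mu>\<close> would contradict \<open>0 < Q\<close>.\<close>

lemma square_le_of_weighted_AM_GM:
  fixes Q A V :: real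
  assumes le: "\<And>\<mu>. 0 < \<mu> \<Longrightarrow> 2 * Q \<le> \<mu> * A + V / \<mu>" and "0 \<le> Q" "0 \<le> A" "0 \<le> V"
  shows "Q\<^sup>2 \<le> A * V"
proof (cases "Q = 0")
  case False
  then have Q: "0 < Q" using \<open>0 \<le> Q\<close> by simp
  have "A \<noteq> 0"
  proof
    assume "A = 0"
    then have "2 * Q \<le> V / ((V + 1) / Q)"
      using le[of "(V + 1) / Q"] Q \<open>0 \<le> V\<close> by simp
    also have "\<dots> \<le> Q"
      using Q \<open>0 \<le> V\<close> by (simp add: divide_simps)
    finally show False using Q by simp
  qed
  then have A: "0 < A" using \<open>0 \<le> A\<close> by simp
  have "2 * Q \<le> Q / A * A + V / (Q / A)"
    using Q A by (intro le) simp
  then have "Q \<le> V * A / Q"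
    using Q A by simp
  then show ?thesis
    using Q by (simp add: pos_le_divide_eq power2_eq_square mult.commute)
qed (use assms in simp)

text \<open>Passes from the half-open cube, where the test functions are integrated, to the closed
  cube of the norms.\<close>

lemma cube_integral_le_unit_cube:
  fixes f :: "real ^ 3 \<Rightarrow> real"
  assumes [measurable]: "f \<in> borel_measurable borel"
    and f: "\<And>x. x \<in> unit_cube \<Longrightarrow> 0 \<le> f x \<and> f x \<le> B"
  shows "integral\<^sup>L cube_measure f \<le> (LINT x:unit_cube|lborel. f x)"
proof -
  have sets [measurable]: "unit_cube \<in> sets borel"
    by (simp add: unit_cube_eq_cbox)
  have finite: "emeasure lborel unit_cube < \<infinity>"
    by (simp add: unit_cube_eq_cbox emeasure_lborel_cbox_cart)
  have unit: "integrable lborel (\<lambda>x. indicator unit_cube x *\<^sub>R f x)"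
    using f finite by (intro integrableI_bounded_set_indicator[where B=B] AE_I2) auto
  have "integrable cube_measure f"
    using f dyadic_cube_subset by (intro cube_integrable_bounded[where B=B]) auto
  then have "integrable lborel (\<lambda>x. indicator dyadic_cube x *\<^sub>R f x)"
    unfolding cube_measure_def by (subst (asm) integrable_restrict_space) auto
  then show ?thesis
    unfolding integral_cube_measure set_lebesgue_integral_def using unit f dyadic_cube_subset
    by (intro integral_mono) (auto simp: indicator_def)
qed

text \<open>Ensures that the infimum in \<open>LlogL_norm\<close> is taken over a nonempty
  set.\<close>

lemma LlogL_admissible_nonempty:
  assumes P: "P \<subseteq> unit_cube" "finite P"
  shows "\<exists>r>0. (\<integral>\<^sup>+ x \<in> unit_cube. ennreal (LlogL_young (\<bar>discrepancy P x\<bar> / r)) \<partial>lborel) \<le> 1"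
proof (intro exI conjI)
  \<comment> \<open>With this choice the argument of the Young function is at most 1/2, and its
    value there is at most 1 because \<open>exp 1 + 1 / 2 \<le> exp 2\<close>.\<close>
  let ?r = "2 * (real (card P) + 1)"
  show "0 < ?r" by simp
  have "LlogL_young (\<bar>discrepancy P x\<bar> / ?r) \<le> 1" if "x \<in> unit_cube" for x
  proof -
    have "\<bar>discrepancy P x\<bar> / ?r \<le> 1 / 2"
      using discrepancy_bounded[OF P that] by (simp add: divide_simps)
    then have "LlogL_young (\<bar>discrepancy P x\<bar> / ?r) \<le> LlogL_young (1 / 2)"
      by (intro LlogL_young_mono) auto
    also have "LlogL_young (1 / 2) \<le> 1"
    proof -
      have "ln (exp 1 + 1 / 2) \<le> ln (exp (2 :: real))"
      proof (rule ln_mono)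
        have "exp (2 :: real) = exp 1 * exp 1"
          by (simp flip: exp_add)
        moreover have "2 \<le> exp (1 :: real)"
          using exp_ge_add_one_self[of 1] by simp
        then have "exp 1 * 2 \<le> exp 1 * exp (1 :: real)"
          by (intro mult_left_mono) auto
        ultimately show "exp 1 + 1 / 2 \<le> exp (2 :: real)"
          using \<open>2 \<le> exp (1 :: real)\<close> by linarith
      qed (simp_all add: add_pos_pos)
      then show ?thesis
        by (simp add: LlogL_young_def)
    qed
    finally show ?thesis .
  qed
  then have "(\<integral>\<^sup>+ x \<in> unit_cube. ennreal (LlogL_young (\<bar>discrepancy P x\<bar> / ?r)) \<partial>lborel)
      \<le> (\<integral>\<^sup>+ x. indicator unit_cube x \<partial>lborel)"
    by (intro nn_integral_mono) (auto simp: indicator_def ennreal_le_1)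
  also have "\<dots> = 1"
    by (simp add: unit_cube_eq_cbox emeasure_lborel_cbox_cart)
  finally show "(\<integral>\<^sup>+ x \<in> unit_cube. ennreal (LlogL_young (\<bar>discrepancy P x\<bar> / ?r)) \<partial>lborel) \<le> 1" .
qed

text \<open>Young's inequality with \<open>s = \<bar>discrepancy P x\<bar> / r\<close> and
  \<open>t = (G x)\<^sup>2 / \<kappa>\<close>; the constant 3 is the sum of the bounds 1 and 2 for
  the two integrals.\<close>

lemma LlogL_duality:
  assumes P: "P \<subseteq> unit_cube" "finite P"
    and [measurable]: "G \<in> borel_measurable borel" and G: "\<And>x. \<bar>G x\<bar> \<le> B"
    and "0 < \<kappa>" and exp_G: "(\<integral>x. exp ((G x)\<^sup>2 / \<kappa>) \<partial>cube_measure) \<le> 2"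
    and "0 < r"
    and r: "(\<integral>\<^sup>+ x \<in> unit_cube. ennreal (LlogL_young (\<bar>discrepancy P x\<bar> / r)) \<partial>lborel) \<le> 1"
  shows "(\<integral>x. \<bar>discrepancy P x\<bar> * (G x)\<^sup>2 \<partial>cube_measure) \<le> 3 * \<kappa> * r"
proof -
  note [measurable] = measurable_discrepancy[OF P]
  let ?Y = "\<lambda>x. LlogL_young (\<bar>discrepancy P x\<bar> / r)"
  let ?E = "\<lambda>x. exp ((G x)\<^sup>2 / \<kappa>)"
  let ?V = "\<lambda>x. \<bar>discrepancy P x\<bar> * (G x)\<^sup>2"
  have D: "\<bar>discrepancy P x\<bar> \<le> real (card P)" if "x \<in> dyadic_cube" for x
    using that discrepancy_bounded[OF P] dyadic_cube_subset by blast
  have G2: "(G x)\<^sup>2 \<le> B\<^sup>2" for x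
    using power_mono[OF G[of x], of 2] by simp
  have Y0: "0 \<le> ?Y x" for x
    using \<open>0 < r\<close> by (intro LlogL_young_nonneg) simp
  have [measurable]: "?Y \<in> borel_measurable borel"
    unfolding LlogL_young_def by measurable
  have int_Y: "integrable cube_measure ?Y"
  proof (rule cube_integrable_bounded)
    fix x assume "x \<in> dyadic_cube"
    then show "\<bar>?Y x\<bar> \<le> LlogL_young (real (card P) / r)"
      using D Y0 \<open>0 < r\<close> by (auto intro!: LlogL_young_mono divide_right_mono)
  qed measurable
  have int_E: "integrable cube_measure ?E"
    using G2 \<open>0 < \<kappa>\<close>
    by (intro cube_integrable_bounded[where B="exp (B\<^sup>2 / \<kappa>)"]) (auto intro: divide_right_mono)
  have int_V: "integrable cube_measure ?V"
  proof (rule cube_integrable_bounded)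
    fix x assume "x \<in> dyadic_cube"
    then show "\<bar>?V x\<bar> \<le> real (card P) * B\<^sup>2"
      unfolding abs_mult using D G2 by (intro mult_mono) auto
  qed measurable
  have "ennreal (integral\<^sup>L cube_measure ?Y) = (\<integral>\<^sup>+x. ennreal (?Y x) \<partial>cube_measure)"
    using nn_integral_eq_integral[OF int_Y] Y0 by simp
  also have "\<dots> \<le> (\<integral>\<^sup>+ x \<in> unit_cube. ennreal (?Y x) \<partial>lborel)"
    unfolding nn_integral_cube_measure using dyadic_cube_subset
    by (intro nn_integral_mono) (auto simp: indicator_def)
  also note r
  finally have Y1: "integral\<^sup>L cube_measure ?Y \<le> 1"
    by simp
  have pointwise: "?V x / (\<kappa> * r) \<le> ?Y x + ?E x" for x
    using young_exp_log[of "\<bar>discrepancy P x\<bar> / r" "(G x)\<^sup>2 / \<kappa>"] \<open>0 < r\<close> by (simp add: mult.commute)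
  have "integral\<^sup>L cube_measure ?V / (\<kappa> * r) = (\<integral>x. ?V x / (\<kappa> * r) \<partial>cube_measure)"
    by simp
  also have "\<dots> \<le> (\<integral>x. ?Y x + ?E x \<partial>cube_measure)"
    using int_V int_Y int_E pointwise by (intro integral_mono) auto
  also have "\<dots> \<le> 3"
    using int_Y int_E Y1 exp_G by simp
  finally show ?thesis
    using \<open>0 < \<kappa>\<close> \<open>0 < r\<close> by (simp add: pos_divide_le_eq mult_ac)
qed

text \<open>Cauchy-Schwarz for the measure with density \<open>\<bar>discrepancy P x\<bar>\<close>,
  applied to the constant 1 and \<open>\<bar>G x\<bar>\<close>.\<close>

lemma integral_square_le_weighted:
  assumes P: "P \<subseteq> unit_cube" "finite P"
    and [measurable]: "G \<in> borel_measurable borel" and G: "\<And>x. \<bar>G x\<bar> \<le> B"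
    and Q: "0 \<le> (\<integral>x. discrepancy P x * G x \<partial>cube_measure)"
  shows "(\<integral>x. discrepancy P x * G x \<partial>cube_measure)\<^sup>2
    \<le> L1_norm (discrepancy P) * (\<integral>x. \<bar>discrepancy P x\<bar> * (G x)\<^sup>2 \<partial>cube_measure)"
proof (rule square_le_of_weighted_AM_GM)
  note [measurable] = measurable_discrepancy[OF P]
  let ?D = "discrepancy P"
  have D: "\<bar>?D x\<bar> \<le> real (card P)" if "x \<in> dyadic_cube" for x
    using that discrepancy_bounded[OF P] dyadic_cube_subset by blast
  have G2: "(G x)\<^sup>2 \<le> B\<^sup>2" for x
    using power_mono[OF G[of x], of 2] by simp
  have A: "integral\<^sup>L cube_measure (\<lambda>x. \<bar>?D x\<bar>) \<le> L1_norm ?D"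
    unfolding L1_norm_def
    by (rule cube_integral_le_unit_cube[where B="real (card P)"]) (auto intro: discrepancy_bounded[OF P])
  show "0 \<le> L1_norm ?D"
    by (rule order_trans[OF _ A]) simp
  show "0 \<le> (\<integral>x. \<bar>?D x\<bar> * (G x)\<^sup>2 \<partial>cube_measure)"
    by simp
  show "0 \<le> (\<integral>x. ?D x * G x \<partial>cube_measure)"
    by (rule Q)
  have int_D: "integrable cube_measure (\<lambda>x. \<bar>?D x\<bar>)"
    by (rule cube_integrable_bounded[where B="real (card P)"]) (auto intro: D)
  have int_DG: "integrable cube_measure (\<lambda>x. ?D x * G x)"
    using G by (intro cube_integrable_discrepancy_mult[OF P, where B=B]) auto
  have int_V: "integrable cube_measure (\<lambda>x. \<bar>?D x\<bar> * (G x)\<^sup>2)"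
  proof (rule cube_integrable_bounded)
    fix x assume "x \<in> dyadic_cube"
    then show "\<bar>\<bar>?D x\<bar> * (G x)\<^sup>2\<bar> \<le> real (card P) * B\<^sup>2"
      unfolding abs_mult using D G2 by (intro mult_mono) auto
  qed measurable
  fix \<mu> :: real assume \<mu>: "0 < \<mu>"
  have AM_GM: "2 * g \<le> \<mu> + g\<^sup>2 / \<mu>" for g
  proof -
    have "(\<mu> - g)\<^sup>2 = \<mu> * \<mu> + g\<^sup>2 - 2 * g * \<mu>"
      by (simp add: power2_eq_square algebra_simps)
    then have "2 * g * \<mu> \<le> \<mu> * \<mu> + g\<^sup>2"
      using zero_le_power2[of "\<mu> - g"] by linarith
    then show ?thesis
      using \<mu> by (simp add: field_simps)
  qed
  have "\<bar>?D x\<bar> * (2 * \<bar>G x\<bar>) \<le> \<bar>?D x\<bar> * (\<mu> + \<bar>G x\<bar>\<^sup>2 / \<mu>)" for x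
    by (intro mult_left_mono AM_GM abs_ge_zero)
  moreover have "2 * (?D x * G x) \<le> \<bar>?D x\<bar> * (2 * \<bar>G x\<bar>)" for x
    using abs_ge_self[of "?D x * G x"] by (simp add: abs_mult)
  ultimately have "2 * (?D x * G x) \<le> \<bar>?D x\<bar> * (\<mu> + \<bar>G x\<bar>\<^sup>2 / \<mu>)" for x
    by (rule order_trans[rotated])
  then have pointwise: "2 * (?D x * G x) \<le> \<mu> * \<bar>?D x\<bar> + \<bar>?D x\<bar> * (G x)\<^sup>2 / \<mu>" for x
    by (simp add: distrib_left mult.commute)
  have "2 * (\<integral>x. ?D x * G x \<partial>cube_measure) = (\<integral>x. 2 * (?D x * G x) \<partial>cube_measure)"
    by simp
  also have "\<dots> \<le> (\<integral>x. \<mu> * \<bar>?D x\<bar> + \<bar>?D x\<bar> * (G x)\<^sup>2 / \<mu> \<partial>cube_measure)"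
    using int_D int_DG int_V pointwise by (intro integral_mono) auto
  also have "\<dots> = \<mu> * (\<integral>x. \<bar>?D x\<bar> \<partial>cube_measure) + (\<integral>x. \<bar>?D x\<bar> * (G x)\<^sup>2 \<partial>cube_measure) / \<mu>"
    using int_D int_V by simp
  also have "\<mu> * (\<integral>x. \<bar>?D x\<bar> \<partial>cube_measure) \<le> \<mu> * L1_norm ?D"
    using A \<mu> by (intro mult_left_mono) auto
  finally show "2 * (\<integral>x. ?D x * G x \<partial>cube_measure)
      \<le> \<mu> * L1_norm ?D + (\<integral>x. \<bar>?D x\<bar> * (G x)\<^sup>2 \<partial>cube_measure) / \<mu>"
    by simp
qed

section \<open>The test function\<close>

lemma discrepancy_norm_product_ge:
  assumes P: "P \<subseteq> unit_cube" "finite P"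
    and n: "2 * real (card P) \<le> 2 ^ n" "2 ^ n \<le> 4 * real (card P)"
    and "0 < r"
    and r: "(\<integral>\<^sup>+ x \<in> unit_cube. ennreal (LlogL_young (\<bar>discrepancy P x\<bar> / r)) \<partial>lborel) \<le> 1"
  shows "(real (Suc n))\<^sup>2 / (48 * 2 ^ 30) \<le> L1_norm (discrepancy P) * r"
proof -
  let ?D = "discrepancy P"
  define L where "L = real (Suc n)"
  \<comment> \<open>Small enough for both demands at every \<open>k\<close>: at most 1/16 since
    \<open>L \<ge> 1\<close>, and \<open>real (Suc (n - k)) * \<delta>\<^sup>2\<close> is at most
    1/256.\<close>
  define \<delta> where "\<delta> = 1 / (16 * sqrt L)"
  \<comment> \<open>With \<open>m = n - k\<close> all boxes have volume \<open>1 / 2 ^ n\<close>,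
    whatever the scale \<open>k\<close> of the first coordinate.\<close>
  define h where "h = (\<lambda>k. riesz P k (n - k) \<delta> {..<Suc (n - k)})"
  define G where "G = (\<lambda>x. \<Sum>k<Suc n. rad k (x $ 1) * h k x)"
  have L: "1 \<le> L" "0 < L"
    by (auto simp: L_def)
  then have \<delta>: "0 < \<delta>" "\<delta> \<le> 1 / 16" "\<delta>\<^sup>2 = 1 / (256 * L)"
    by (auto simp: \<delta>_def power_divide power_mult_distrib divide_simps)
  have \<delta>_small: "real (Suc (n - k)) * \<delta>\<^sup>2 \<le> 1" for k
  proof -
    have "real (Suc (n - k)) \<le> L"
      by (simp add: L_def)
    then show ?thesis
      using L by (simp add: \<delta> divide_simps)
  qed
  have [measurable]: "h k \<in> borel_measurable borel" for k
    unfolding h_def by (rule measurable_riesz[OF P(2)])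
  have h_bound: "\<bar>h k x\<bar> \<le> 2" for k x
    unfolding h_def using \<delta> \<delta>_small[of k] by (intro abs_riesz_le) auto
  \<comment> \<open>\<open>h k\<close> sees the first coordinate only through its
    level-\<open>k\<close> cell; this makes the summands of \<open>G\<close> martingale
    differences.\<close>
  have h_inv: "h k (half_swap 1 l x) = h k x" if "k \<le> l" for k l x
  proof -
    have "planar_haar P k (n - k) j (half_swap 1 l x) = planar_haar P k (n - k) j x" for j
      using that by (simp add: planar_haar_def empty_box_def same_box_def dcell_half_swap)
    then show ?thesis
      by (simp add: h_def riesz_def)
  qed
  have [measurable]: "G \<in> borel_measurable borel"
    unfolding G_def by measurable
  have G_bound: "\<bar>G x\<bar> \<le> L * 2" for x
  proof -
    have "\<bar>G x\<bar> \<le> (\<Sum>k<Suc n. \<bar>rad k (x $ 1) * h k x\<bar>)"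
      unfolding G_def by (rule sum_abs)
    also have "\<dots> \<le> real (card {..<Suc n}) * 2"
      by (rule sum_bounded_above) (simp add: abs_mult h_bound)
    finally show ?thesis by (simp add: L_def)
  qed
  have exp_G: "(\<integral>x. exp ((G x)\<^sup>2 / (16 * L)) \<partial>cube_measure) \<le> 2"
  proof -
    \<comment> \<open>Both parameters of the martingale bound are \<open>Suc n\<close>, so the
      denominator is \<open>16 * L\<close> and the bound is \<open>exp (1 / 2)\<close>.\<close>
    have "(\<integral>x. exp ((G x)\<^sup>2 / (8 * real (Suc n + Suc n))) \<partial>cube_measure)
        \<le> exp (real (Suc n) / (2 * real (Suc n)))"
      unfolding G_def by (rule integral_exp_square_martingale_le) (auto simp: h_bound h_inv)
    moreover have "8 * real (Suc n + Suc n) = 16 * L" "real (Suc n) / (2 * real (Suc n)) = 1 / 2"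
      by (simp_all add: L_def)
    ultimately show ?thesis
      using exp_half_le_2 by (simp only:)
  qed
  have V: "(\<integral>x. \<bar>?D x\<bar> * (G x)\<^sup>2 \<partial>cube_measure) \<le> 3 * (16 * L) * r"
    using G_bound L exp_G \<open>0 < r\<close> r by (intro LlogL_duality[OF P, where B="L * 2"]) auto
  let ?I = "\<integral>x. ?D x * G x \<partial>cube_measure"
  have "?I = (\<integral>x. (\<Sum>k<Suc n. ?D x * (rad k (x $ 1) * h k x)) \<partial>cube_measure)"
    unfolding G_def sum_distrib_left ..
  also have "\<dots> = (\<Sum>k<Suc n. \<integral>x. ?D x * (rad k (x $ 1) * h k x) \<partial>cube_measure)"
    by (intro Bochner_Integration.integral_sum cube_integrable_discrepancy_mult[OF P, where B=2])
      (auto simp: abs_mult h_bound)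
  also have "\<dots> \<ge> (\<Sum>k<Suc n. \<delta> / 2 ^ 10 * real (Suc (n - k)))"
  proof (rule sum_mono)
    fix k assume "k \<in> {..<Suc n}"
    then have k: "k + (n - k) = n" by simp
    have "\<delta> / 2 ^ 10 * real (Suc (n - k)) = 1 / 2 ^ 10 * (\<delta> * real (Suc (n - k)))"
      by simp
    also have "\<dots> \<le> real (card P) / 2 ^ (n + 8) * (\<delta> * real (Suc (n - k)))"
    proof (rule mult_right_mono)
      \<comment> \<open>The inequality \<open>2 ^ n \<le> 4 * real (card P)\<close> enters here,
        turning the exponent 8 into 10.\<close>
      show "1 / 2 ^ 10 \<le> real (card P) / 2 ^ (n + 8)"
        using n(2) by (simp add: power_add divide_simps)
    qed (use \<delta> in simp)
    also have "\<dots> \<le> (\<integral>x. ?D x * (rad k (x $ 1) * h k x) \<partial>cube_measure)"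
      using discrepancy_riesz_ge[OF P, of k "n - k" \<delta>] n(1) \<delta> \<delta>_small[of k] unfolding k h_def by simp
    finally show "\<delta> / 2 ^ 10 * real (Suc (n - k)) \<le> (\<integral>x. ?D x * (rad k (x $ 1) * h k x) \<partial>cube_measure)" .
  qed
  also have "(\<Sum>k<Suc n. \<delta> / 2 ^ 10 * real (Suc (n - k))) = \<delta> / 2 ^ 10 * (\<Sum>k<Suc n. real (Suc k))"
    unfolding sum_distrib_left using sum.nat_diff_reindex[of "\<lambda>k. \<delta> / 2 ^ 10 * real (Suc k)" "Suc n"]
    by simp
  also have "(\<Sum>k<Suc n. real (Suc k)) = L * (L + 1) / 2"
    unfolding L_def by (induction n) (auto simp: field_simps)
  finally have "\<delta> / 2 ^ 10 * (L * (L + 1) / 2) \<le> ?I" .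
  moreover have "\<delta> / 2 ^ 11 * L\<^sup>2 \<le> \<delta> / 2 ^ 10 * (L * (L + 1) / 2)"
    using \<delta> L by (simp add: power2_eq_square divide_simps)
  ultimately have I: "\<delta> / 2 ^ 11 * L\<^sup>2 \<le> ?I"
    by linarith
  then have I0: "0 \<le> ?I"
    using \<delta> by (intro order_trans[OF _ I]) simp
  \<comment> \<open>\<open>\<delta>\<^sup>2\<close> contributes \<open>1 / (2 ^ 8 * L)\<close>,
    hence the cube and the exponent 30. One power of \<open>L\<close> then cancels against the
    factor \<open>3 * (16 * L)\<close> of \<open>V\<close>, which leaves 48 in the final
    constant.\<close>
  have "L ^ 3 / 2 ^ 30 = (\<delta> / 2 ^ 11 * L\<^sup>2)\<^sup>2"
  proof -
    have "(\<delta> / 2 ^ 11 * L\<^sup>2)\<^sup>2 = \<delta>\<^sup>2 * L ^ 4 / 2 ^ 22"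
      by (simp add: power_mult_distrib power_divide)
    also have "\<dots> = L ^ 3 / 2 ^ 30"
      using L unfolding \<delta>(3) by (simp add: field_simps eval_nat_numeral)
    finally show ?thesis ..
  qed
  also have "\<dots> \<le> ?I\<^sup>2"
    using I \<delta> by (intro power_mono) auto
  also have "\<dots> \<le> L1_norm ?D * (\<integral>x. \<bar>?D x\<bar> * (G x)\<^sup>2 \<partial>cube_measure)"
    using G_bound I0 by (intro integral_square_le_weighted[OF P]) auto
  also have "\<dots> \<le> L1_norm ?D * (3 * (16 * L) * r)"
    by (intro mult_left_mono V) (simp add: L1_norm_def set_lebesgue_integral_def)
  finally show ?thesis
    using L unfolding L_def[symmetric] by (simp add: field_simps power2_eq_square power3_eq_cube)
qed

theorem theorem1p6:
  shows "\<exists>c::real. c > 0 \<and>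
    (\<forall>N::nat. \<forall>P::(real ^ 3) set.
       N \<ge> 1 \<longrightarrow> P \<subseteq> unit_cube \<longrightarrow> finite P \<longrightarrow> card P = N \<longrightarrow>
       L1_norm (discrepancy P) * LlogL_norm (discrepancy P) \<ge> c * (ln (real N))\<^sup>2)"
proof (intro exI conjI allI impI)
  show "0 < 1 / (48 * 2 ^ 30 :: real)" by simp
  fix N :: nat and P :: "(real ^ 3) set"
  assume N: "1 \<le> N" and P: "P \<subseteq> unit_cube" "finite P" and card: "card P = N"
  \<comment> \<open>Since \<open>N\<close> lies between \<open>2 ^ floor_log N\<close> and twice
    that power, adding 2 to the exponent puts \<open>2 ^ n\<close> between \<open>2 * N\<close> and
    \<open>4 * N\<close>.\<close>
  define n where "n = Suc (Suc (floor_log N))"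
  have n: "2 * real (card P) \<le> 2 ^ n" "2 ^ n \<le> 4 * real (card P)"
  proof -
    have "2 ^ floor_log N \<le> N" "N < 2 * 2 ^ floor_log N"
      using N floor_log_exp2_le[of N] floor_log_exp2_gt[of N] by auto
    then have "2 * N \<le> 2 ^ n" "2 ^ n \<le> 4 * N"
      by (auto simp: n_def)
    then have "real (2 * N) \<le> real (2 ^ n)" "real (2 ^ n) \<le> real (4 * N)"
      by (simp_all only: of_nat_le_iff)
    then show "2 * real (card P) \<le> 2 ^ n" "2 ^ n \<le> 4 * real (card P)"
      by (simp_all add: card)
  qed
  have "ln (real N) \<le> ln (2 ^ n)"
  proof (rule ln_mono)
    show "real N \<le> 2 ^ n"
      using n(1) card by linarith
  qed (use N in auto)
  also have "\<dots> = real n * ln 2"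
    by (simp add: ln_realpow)
  also have "\<dots> \<le> real n * 1"
    using ln_2_less_1 by (intro mult_left_mono) auto
  finally have "(ln (real N))\<^sup>2 \<le> (real (Suc n))\<^sup>2"
    using N by (intro power_mono) auto
  then have c: "1 / (48 * 2 ^ 30) * (ln (real N))\<^sup>2 \<le> (real (Suc n))\<^sup>2 / (48 * 2 ^ 30)"
    by simp
  let ?A = "L1_norm (discrepancy P)"
  let ?R = "{r::real. 0 < r \<and>
    (\<integral>\<^sup>+ x \<in> unit_cube. ennreal (LlogL_young (\<bar>discrepancy P x\<bar> / r)) \<partial>lborel) \<le> 1}"
  have R: "(real (Suc n))\<^sup>2 / (48 * 2 ^ 30) \<le> ?A * r" if "r \<in> ?R" for r
    using that discrepancy_norm_product_ge[OF P n] by blast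
  obtain r0 where r0: "r0 \<in> ?R"
    using LlogL_admissible_nonempty[OF P] by blast
  \<comment> \<open>The bound in terms of \<open>Suc n\<close> stays positive even for
    \<open>N = 1\<close>, where the logarithm is zero; so \<open>?A\<close> is positive and may be
    divided by.\<close>
  have "0 < (real (Suc n))\<^sup>2 / (48 * 2 ^ 30)"
    by simp
  then have "0 < ?A * r0"
    using R[OF r0] by linarith
  then have A: "0 < ?A"
    using r0 by (simp add: zero_less_mult_iff)
  \<comment> \<open>The bound holds for every admissible \<open>r\<close> and so passes to the
    infimum.\<close>
  have "(real (Suc n))\<^sup>2 / (48 * 2 ^ 30) / ?A \<le> LlogL_norm (discrepancy P)"
    unfolding LlogL_norm_def
  proof (rule cInf_greatest)
    fix r assume "r \<in> ?R"
    then show "(real (Suc n))\<^sup>2 / (48 * 2 ^ 30) / ?A \<le> r"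
      using R[of r] A by (simp only: pos_divide_le_eq mult.commute)
  qed (use r0 in blast)
  then have "(real (Suc n))\<^sup>2 / (48 * 2 ^ 30) \<le> ?A * LlogL_norm (discrepancy P)"
    using A by (simp only: pos_divide_le_eq mult.commute)
  with c show "1 / (48 * 2 ^ 30) * (ln (real N))\<^sup>2 \<le> ?A * LlogL_norm (discrepancy P)"
    by (rule order_trans)
qed

end
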